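(* Let $\mathcal{A}$ be a category with a strict initial object. Then the codomain functor $\mathsf{cod} \colon \mathcal{A}^2 \to \mathcal{A}$ preserves effective descent morphisms.
   Context: $\mathcal{A}^2$ is the arrow category of $\mathcal{A}$: objects are morphisms of $\mathcal{A}$, and morphisms are commutative squares; $\mathsf{cod}$ (the codomain opfibration) sends a morphism to its codomain. It is the op-Grothendieck construction of the functor $\mathcal{A} \to \mathsf{CAT}$ sending $a$ to the slice category $\mathcal{A}\downarrow a$ and $p \colon a \to b$ to $p_! \colon \mathcal{A}\downarrow a \to \mathcal{A}\downarrow b$, $f \mapsto p\circ f$. An initial object $\mathsf{0}$ of a category is strict if every object $x$ admitting a morphism $x \to \mathsf{0}$ is isomorphic to $\mathsf{0}$. A morphism $p \colon a \to b$ in a category $\mathcal{X}$ is an effective descent morphism if all pullbacks along $p$ exist in $\mathcal{X}$ (equivalently, the functor $p_! \colon \mathcal{X} \downarrow a \to \mathcal{X} \downarrow b$, $f \mapsto p \circ f$, between slice categories has a right adjoint $p^*$) and $p^*$ is monadic (its comparison functor into the Eilenberg-Moore category of the monad induced by $p_! \dashv p^*$ is an equivalence). No existence of other pullbacks in $\mathcal{X}$ is assumed. A functor $F$ preserves effective descent morphisms if $F(p)$ is an effective descent morphism whenever $p$ is. *)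

theory Defs
  imports Main
begin

section \<open>Categories\<close>

record ('o, 'm) cat =
  Ob :: "'o set"
  Ar :: "'m set"
  Dom :: "'m \<Rightarrow> 'o"
  Cod :: "'m \<Rightarrow> 'o"
  Ide :: "'o \<Rightarrow> 'm"
  Cmp :: "'m \<Rightarrow> 'm \<Rightarrow> 'm" (infixl \<open>\<cdot>\<index>\<close> 70)

definition hom :: "('o, 'm) cat \<Rightarrow> 'o \<Rightarrow> 'o \<Rightarrow> 'm set" where
  "hom C x y = {f \<in> Ar C. Dom C f = x \<and> Cod C f = y}"

text \<open>\<open>g \<cdot> f\<close> is \<open>g\<close> after \<open>f\<close>. The operations are unconstrained outside the carrier sets.\<close>

locale category =
  fixes C :: "('o, 'm) cat" (structure)
  assumes Dom_in [simp, intro]: "f \<in> Ar C \<Longrightarrow> Dom C f \<in> Ob C"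
    and Cod_in [simp, intro]: "f \<in> Ar C \<Longrightarrow> Cod C f \<in> Ob C"
    and Ide_hom: "x \<in> Ob C \<Longrightarrow> Ide C x \<in> hom C x x"
    and Cmp_hom: "\<lbrakk>f \<in> hom C x y; g \<in> hom C y z\<rbrakk> \<Longrightarrow> g \<cdot> f \<in> hom C x z"
    and Cmp_Ide: "f \<in> hom C x y \<Longrightarrow> f \<cdot> Ide C x = f"
    and Ide_Cmp: "f \<in> hom C x y \<Longrightarrow> Ide C y \<cdot> f = f"
    and Cmp_assoc: "\<lbrakk>f \<in> hom C w x; g \<in> hom C x y; h \<in> hom C y z\<rbrakk>
                      \<Longrightarrow> h \<cdot> (g \<cdot> f) = (h \<cdot> g) \<cdot> f"

definition iso_arr :: "('o, 'm) cat \<Rightarrow> 'm \<Rightarrow> bool" where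
  "iso_arr C f \<longleftrightarrow> f \<in> Ar C \<and>
     (\<exists>g \<in> hom C (Cod C f) (Dom C f).
        Cmp C g f = Ide C (Dom C f) \<and> Cmp C f g = Ide C (Cod C f))"

definition isomorphic :: "('o, 'm) cat \<Rightarrow> 'o \<Rightarrow> 'o \<Rightarrow> bool" where
  "isomorphic C x y \<longleftrightarrow> (\<exists>f \<in> hom C x y. iso_arr C f)"

definition initial :: "('o, 'm) cat \<Rightarrow> 'o \<Rightarrow> bool" where
  "initial C z \<longleftrightarrow> z \<in> Ob C \<and> (\<forall>x \<in> Ob C. \<exists>!f. f \<in> hom C z x)"

definition strict_initial :: "('o, 'm) cat \<Rightarrow> 'o \<Rightarrow> bool" where
  "strict_initial C z \<longleftrightarrow> initial C z \<and>
     (\<forall>x \<in> Ob C. hom C x z \<noteq> {} \<longrightarrow> isomorphic C x z)"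

text \<open>\<open>r\<close> and \<open>s\<close> are the two projections of a pullback of the cospan \<open>(p, q)\<close>.\<close>

definition is_pullback :: "('o, 'm) cat \<Rightarrow> 'm \<Rightarrow> 'm \<Rightarrow> 'm \<Rightarrow> 'm \<Rightarrow> bool" where
  "is_pullback C p q r s \<longleftrightarrow>
     p \<in> Ar C \<and> q \<in> Ar C \<and> Cod C p = Cod C q \<and>
     r \<in> Ar C \<and> s \<in> Ar C \<and> Dom C r = Dom C s \<and>
     Cod C r = Dom C p \<and> Cod C s = Dom C q \<and> Cmp C p r = Cmp C q s \<and>
     (\<forall>x \<in> Ob C. \<forall>f \<in> hom C x (Dom C p). \<forall>g \<in> hom C x (Dom C q).
        Cmp C p f = Cmp C q g \<longrightarrow>
        (\<exists>!h. h \<in> hom C x (Dom C r) \<and> Cmp C r h = f \<and> Cmp C s h = g))"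

definition has_pullbacks_along :: "('o, 'm) cat \<Rightarrow> 'm \<Rightarrow> bool" where
  "has_pullbacks_along C p \<longleftrightarrow>
     (\<forall>q \<in> Ar C. Cod C q = Cod C p \<longrightarrow> (\<exists>r s. is_pullback C p q r s))"


section \<open>Functors, natural transformations, equivalences\<close>

record ('o, 'm, 'p, 'n) ftr =
  Fo :: "'o \<Rightarrow> 'p"
  Fa :: "'m \<Rightarrow> 'n"

definition is_functor ::
    "('o, 'm) cat \<Rightarrow> ('p, 'n) cat \<Rightarrow> ('o, 'm, 'p, 'n) ftr \<Rightarrow> bool" where
  "is_functor C D F \<longleftrightarrow> category C \<and> category D \<and>
     (\<forall>x \<in> Ob C. Fo F x \<in> Ob D) \<and>
     (\<forall>f \<in> Ar C. Fa F f \<in> hom D (Fo F (Dom C f)) (Fo F (Cod C f))) \<and>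
     (\<forall>x \<in> Ob C. Fa F (Ide C x) = Ide D (Fo F x)) \<and>
     (\<forall>f \<in> Ar C. \<forall>g \<in> Ar C. Cod C f = Dom C g \<longrightarrow>
        Fa F (Cmp C g f) = Cmp D (Fa F g) (Fa F f))"

definition id_ftr :: "('o, 'm, 'o, 'm) ftr" where
  "id_ftr = \<lparr>Fo = (\<lambda>x. x), Fa = (\<lambda>f. f)\<rparr>"

definition comp_ftr ::
    "('p, 'n, 'q, 'k) ftr \<Rightarrow> ('o, 'm, 'p, 'n) ftr \<Rightarrow> ('o, 'm, 'q, 'k) ftr" where
  "comp_ftr G F = \<lparr>Fo = (\<lambda>x. Fo G (Fo F x)), Fa = (\<lambda>f. Fa G (Fa F f))\<rparr>"

definition nat_trans ::
    "('o, 'm) cat \<Rightarrow> ('p, 'n) cat \<Rightarrow> ('o, 'm, 'p, 'n) ftr \<Rightarrow> ('o, 'm, 'p, 'n) ftr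
       \<Rightarrow> ('o \<Rightarrow> 'n) \<Rightarrow> bool" where
  "nat_trans C D F G \<tau> \<longleftrightarrow> is_functor C D F \<and> is_functor C D G \<and>
     (\<forall>x \<in> Ob C. \<tau> x \<in> hom D (Fo F x) (Fo G x)) \<and>
     (\<forall>f \<in> Ar C. Cmp D (\<tau> (Cod C f)) (Fa F f) = Cmp D (Fa G f) (\<tau> (Dom C f)))"

definition nat_iso ::
    "('o, 'm) cat \<Rightarrow> ('p, 'n) cat \<Rightarrow> ('o, 'm, 'p, 'n) ftr \<Rightarrow> ('o, 'm, 'p, 'n) ftr
       \<Rightarrow> ('o \<Rightarrow> 'n) \<Rightarrow> bool" where
  "nat_iso C D F G \<tau> \<longleftrightarrow> nat_trans C D F G \<tau> \<and> (\<forall>x \<in> Ob C. iso_arr D (\<tau> x))"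

definition is_equivalence ::
    "('o, 'm) cat \<Rightarrow> ('p, 'n) cat \<Rightarrow> ('o, 'm, 'p, 'n) ftr \<Rightarrow> bool" where
  "is_equivalence C D F \<longleftrightarrow> is_functor C D F \<and>
     (\<exists>G \<alpha> \<beta>. is_functor D C G \<and>
        nat_iso C C id_ftr (comp_ftr G F) \<alpha> \<and> nat_iso D D (comp_ftr F G) id_ftr \<beta>)"


section \<open>Adjunctions, monads, Eilenberg--Moore categories\<close>

text \<open>\<open>F : C \<rightarrow> D\<close> is left adjoint to \<open>U : D \<rightarrow> C\<close>, with unit \<open>\<eta>\<close> and counit \<open>\<epsilon>\<close>.\<close>

definition adjunction ::
    "('o, 'm) cat \<Rightarrow> ('p, 'n) cat \<Rightarrow> ('o, 'm, 'p, 'n) ftr \<Rightarrow> ('p, 'n, 'o, 'm) ftr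
       \<Rightarrow> ('o \<Rightarrow> 'm) \<Rightarrow> ('p \<Rightarrow> 'n) \<Rightarrow> bool" where
  "adjunction C D F U \<eta> \<epsilon> \<longleftrightarrow> is_functor C D F \<and> is_functor D C U \<and>
     nat_trans C C id_ftr (comp_ftr U F) \<eta> \<and>
     nat_trans D D (comp_ftr F U) id_ftr \<epsilon> \<and>
     (\<forall>x \<in> Ob C. Cmp D (\<epsilon> (Fo F x)) (Fa F (\<eta> x)) = Ide D (Fo F x)) \<and>
     (\<forall>y \<in> Ob D. Cmp C (Fa U (\<epsilon> y)) (\<eta> (Fo U y)) = Ide C (Fo U y))"

definition is_monad ::
    "('o, 'm) cat \<Rightarrow> ('o, 'm, 'o, 'm) ftr \<Rightarrow> ('o \<Rightarrow> 'm) \<Rightarrow> ('o \<Rightarrow> 'm) \<Rightarrow> bool" where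
  "is_monad C T \<eta> \<mu> \<longleftrightarrow>
     nat_trans C C id_ftr T \<eta> \<and> nat_trans C C (comp_ftr T T) T \<mu> \<and>
     (\<forall>x \<in> Ob C. Cmp C (\<mu> x) (Fa T (\<eta> x)) = Ide C (Fo T x) \<and>
                  Cmp C (\<mu> x) (\<eta> (Fo T x)) = Ide C (Fo T x) \<and>
                  Cmp C (\<mu> x) (Fa T (\<mu> x)) = Cmp C (\<mu> x) (\<mu> (Fo T x)))"

definition EM_alg ::
    "('o, 'm) cat \<Rightarrow> ('o, 'm, 'o, 'm) ftr \<Rightarrow> ('o \<Rightarrow> 'm) \<Rightarrow> ('o \<Rightarrow> 'm) \<Rightarrow> ('o \<times> 'm) set" where
  "EM_alg C T \<eta> \<mu> = {(x, h). x \<in> Ob C \<and> h \<in> hom C (Fo T x) x \<and>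
     Cmp C h (\<eta> x) = Ide C x \<and> Cmp C h (\<mu> x) = Cmp C h (Fa T h)}"

text \<open>Arrows are triples \<open>(domain, underlying arrow, codomain)\<close>, so that domain and codomain
  are functions of the arrow; likewise in the slice and arrow categories below.\<close>

definition EM_cat ::
    "('o, 'm) cat \<Rightarrow> ('o, 'm, 'o, 'm) ftr \<Rightarrow> ('o \<Rightarrow> 'm) \<Rightarrow> ('o \<Rightarrow> 'm)
       \<Rightarrow> ('o \<times> 'm, ('o \<times> 'm) \<times> 'm \<times> ('o \<times> 'm)) cat" where
  "EM_cat C T \<eta> \<mu> =
     \<lparr>Ob = EM_alg C T \<eta> \<mu>,
      Ar = {((x, h), f, (y, k)). (x, h) \<in> EM_alg C T \<eta> \<mu> \<and> (y, k) \<in> EM_alg C T \<eta> \<mu> \<and>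
              f \<in> hom C x y \<and> Cmp C f h = Cmp C k (Fa T f)},
      Dom = (\<lambda>(a, f, b). a),
      Cod = (\<lambda>(a, f, b). b),
      Ide = (\<lambda>(x, h). ((x, h), Ide C x, (x, h))),
      Cmp = (\<lambda>(b', g, c) (a, f, b). (a, Cmp C g f, c))\<rparr>"

definition adj_EM_cat ::
    "('o, 'm) cat \<Rightarrow> ('o, 'm, 'p, 'n) ftr \<Rightarrow> ('p, 'n, 'o, 'm) ftr
       \<Rightarrow> ('o \<Rightarrow> 'm) \<Rightarrow> ('p \<Rightarrow> 'n) \<Rightarrow> ('o \<times> 'm, ('o \<times> 'm) \<times> 'm \<times> ('o \<times> 'm)) cat" where
  "adj_EM_cat C F U \<eta> \<epsilon> = EM_cat C (comp_ftr U F) \<eta> (\<lambda>x. Fa U (\<epsilon> (Fo F x)))"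

definition comparison_ftr ::
    "('p, 'n) cat \<Rightarrow> ('p, 'n, 'o, 'm) ftr \<Rightarrow> ('p \<Rightarrow> 'n)
       \<Rightarrow> ('p, 'n, 'o \<times> 'm, ('o \<times> 'm) \<times> 'm \<times> ('o \<times> 'm)) ftr" where
  "comparison_ftr D U \<epsilon> =
     \<lparr>Fo = (\<lambda>y. (Fo U y, Fa U (\<epsilon> y))),
      Fa = (\<lambda>g. ((Fo U (Dom D g), Fa U (\<epsilon> (Dom D g))), Fa U g,
                 (Fo U (Cod D g), Fa U (\<epsilon> (Cod D g)))))\<rparr>"

definition monadic_adjunction ::
    "('o, 'm) cat \<Rightarrow> ('p, 'n) cat \<Rightarrow> ('o, 'm, 'p, 'n) ftr \<Rightarrow> ('p, 'n, 'o, 'm) ftr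
       \<Rightarrow> ('o \<Rightarrow> 'm) \<Rightarrow> ('p \<Rightarrow> 'n) \<Rightarrow> bool" where
  "monadic_adjunction C D F U \<eta> \<epsilon> \<longleftrightarrow> adjunction C D F U \<eta> \<epsilon> \<and>
     is_equivalence D (adj_EM_cat C F U \<eta> \<epsilon>) (comparison_ftr D U \<epsilon>)"


section \<open>Slice categories and effective descent\<close>

definition slice_cat :: "('o, 'm) cat \<Rightarrow> 'o \<Rightarrow> ('m, 'm \<times> 'm \<times> 'm) cat" where
  "slice_cat C a =
     \<lparr>Ob = {f \<in> Ar C. Cod C f = a},
      Ar = {(f, h, g). f \<in> Ar C \<and> Cod C f = a \<and> g \<in> Ar C \<and> Cod C g = a \<and>
              h \<in> hom C (Dom C f) (Dom C g) \<and> Cmp C g h = f},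
      Dom = (\<lambda>(f, h, g). f),
      Cod = (\<lambda>(f, h, g). g),
      Ide = (\<lambda>f. (f, Ide C (Dom C f), f)),
      Cmp = (\<lambda>(g', k, e) (f, h, g). (f, Cmp C k h, e))\<rparr>"

definition postcomp_ftr ::
    "('o, 'm) cat \<Rightarrow> 'm \<Rightarrow> ('m, 'm \<times> 'm \<times> 'm, 'm, 'm \<times> 'm \<times> 'm) ftr" where
  "postcomp_ftr C p =
     \<lparr>Fo = (\<lambda>f. Cmp C p f), Fa = (\<lambda>(f, h, g). (Cmp C p f, h, Cmp C p g))\<rparr>"

text \<open>The functor \<open>U\<close> below is \<open>p\<^sup>*\<close>; being a right adjoint of \<open>p\<^sub>!\<close>, it is determined up to
  isomorphism, and so is the monad it induces.\<close>

definition effective_descent :: "('o, 'm) cat \<Rightarrow> 'm \<Rightarrow> bool" where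
  "effective_descent C p \<longleftrightarrow> p \<in> Ar C \<and> has_pullbacks_along C p \<and>
     (\<exists>U \<eta> \<epsilon>. monadic_adjunction (slice_cat C (Dom C p)) (slice_cat C (Cod C p))
                (postcomp_ftr C p) U \<eta> \<epsilon>)"

definition preserves_effective_descent ::
    "('o, 'm) cat \<Rightarrow> ('p, 'n) cat \<Rightarrow> ('o, 'm, 'p, 'n) ftr \<Rightarrow> bool" where
  "preserves_effective_descent C D F \<longleftrightarrow> is_functor C D F \<and>
     (\<forall>p \<in> Ar C. effective_descent C p \<longrightarrow> effective_descent D (Fa F p))"


section \<open>The arrow category and its codomain functor\<close>

text \<open>An arrow \<open>(f, u, v, g)\<close> is the square with \<open>g \<cdot> u = v \<cdot> f\<close>, from \<open>f\<close> to \<open>g\<close>.\<close>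

definition arrow_cat :: "('o, 'm) cat \<Rightarrow> ('m, 'm \<times> 'm \<times> 'm \<times> 'm) cat" where
  "arrow_cat C =
     \<lparr>Ob = Ar C,
      Ar = {(f, u, v, g). f \<in> Ar C \<and> g \<in> Ar C \<and>
              u \<in> hom C (Dom C f) (Dom C g) \<and> v \<in> hom C (Cod C f) (Cod C g) \<and>
              Cmp C g u = Cmp C v f},
      Dom = (\<lambda>(f, u, v, g). f),
      Cod = (\<lambda>(f, u, v, g). g),
      Ide = (\<lambda>f. (f, Ide C (Dom C f), Ide C (Cod C f), f)),
      Cmp = (\<lambda>(g', u', v', k) (f, u, v, g). (f, Cmp C u' u, Cmp C v' v, k))\<rparr>"

definition cod_ftr :: "('o, 'm) cat \<Rightarrow> ('m, 'm \<times> 'm \<times> 'm \<times> 'm, 'o, 'm) ftr" where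
  "cod_ftr C = \<lparr>Fo = Cod C, Fa = (\<lambda>(f, u, v, g). v)\<rparr>"


section \<open>Well-definedness of the constructions\<close>

context category
begin

lemma Ide_simps [simp]:
  assumes "x \<in> Ob C"
  shows "Ide C x \<in> Ar C" "Dom C (Ide C x) = x" "Cod C (Ide C x) = x"
  using Ide_hom[OF assms] by (auto simp: hom_def)

lemma Cmp_simps [simp]:
  assumes "f \<in> Ar C" "g \<in> Ar C" "Dom C g = Cod C f"
  shows "g \<cdot> f \<in> Ar C" "Dom C (g \<cdot> f) = Dom C f" "Cod C (g \<cdot> f) = Cod C g"
  using Cmp_hom[of f "Dom C f" "Cod C f" g "Cod C g"] assms by (auto simp: hom_def)

lemma Cmp_Ide_simps [simp]:
  "\<lbrakk>f \<in> Ar C; x = Dom C f\<rbrakk> \<Longrightarrow> f \<cdot> Ide C x = f"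
  "\<lbrakk>f \<in> Ar C; y = Cod C f\<rbrakk> \<Longrightarrow> Ide C y \<cdot> f = f"
  using Cmp_Ide Ide_Cmp by (auto simp: hom_def)

lemma Cmp_assoc':
  "\<lbrakk>f \<in> Ar C; g \<in> Ar C; h \<in> Ar C; Dom C g = Cod C f; Dom C h = Cod C g\<rbrakk>
     \<Longrightarrow> h \<cdot> (g \<cdot> f) = (h \<cdot> g) \<cdot> f"
  by (rule Cmp_assoc) (auto simp: hom_def)

lemma slice_simps:
  "Ob (slice_cat C a) = {f \<in> Ar C. Cod C f = a}"
  "Dom (slice_cat C a) (f, h, g) = f"
  "Cod (slice_cat C a) (f, h, g) = g"
  "Ide (slice_cat C a) f = (f, Ide C (Dom C f), f)"
  "Cmp (slice_cat C a) (g', k, e) (f, h, g) = (f, k \<cdot> h, e)"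
  by (auto simp: slice_cat_def)

lemma slice_Ar:
  "(f, h, g) \<in> Ar (slice_cat C a) \<longleftrightarrow> f \<in> Ar C \<and> Cod C f = a \<and> g \<in> Ar C \<and> Cod C g = a \<and>
     h \<in> Ar C \<and> Dom C h = Dom C f \<and> Cod C h = Dom C g \<and> g \<cdot> h = f"
  by (simp add: slice_cat_def hom_def)

lemma slice_category: "category (slice_cat C a)" (is "category ?S")
proof
  fix f x y g z
  assume f: "f \<in> hom ?S x y" and g: "g \<in> hom ?S y z"
  obtain h where fd: "f = (x, h, y)" using f by (cases f) (simp add: hom_def slice_simps)
  obtain k where gd: "g = (y, k, z)" using g by (cases g) (simp add: hom_def slice_simps)
  have h: "(x, h, y) \<in> Ar ?S" and k: "(y, k, z) \<in> Ar ?S"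
    using f g by (simp_all add: hom_def fd gd)
  have "z \<cdot> (k \<cdot> h) = (z \<cdot> k) \<cdot> h"
    by (rule Cmp_assoc') (use h k in \<open>simp_all add: slice_Ar\<close>)
  then show "Cmp ?S g f \<in> hom ?S x z"
    using h k by (simp add: hom_def slice_simps slice_Ar fd gd)
next
  fix f w x g y h z
  assume "f \<in> hom ?S w x" "g \<in> hom ?S x y" "h \<in> hom ?S y z"
  then show "Cmp ?S h (Cmp ?S g f) = Cmp ?S (Cmp ?S h g) f"
    by (cases f, cases g, cases h) (simp add: slice_simps slice_Ar hom_def Cmp_assoc')
next
  fix f x y assume "f \<in> hom ?S x y"
  then show "Cmp ?S f (Ide ?S x) = f"
    by (cases f) (simp add: slice_simps slice_Ar hom_def)
next
  fix f x y assume "f \<in> hom ?S x y"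
  then show "Cmp ?S (Ide ?S y) f = f"
    by (cases f) (simp add: slice_simps slice_Ar hom_def)
next
  fix f assume "f \<in> Ob ?S"
  then show "Ide ?S f \<in> hom ?S f f"
    by (simp add: slice_simps slice_Ar hom_def)
next
  fix f assume "f \<in> Ar ?S"
  then show "Dom ?S f \<in> Ob ?S" by (cases f) (simp add: slice_simps slice_Ar)
next
  fix f assume "f \<in> Ar ?S"
  then show "Cod ?S f \<in> Ob ?S" by (cases f) (simp add: slice_simps slice_Ar)
qed

lemma arrow_category: "category (arrow_cat C)"
proof
  fix f x y g z
  assume f: "f \<in> hom (arrow_cat C) x y" and g: "g \<in> hom (arrow_cat C) y z"
  obtain u v where fd: "f = (x, u, v, y)" using f by (auto simp: arrow_cat_def hom_def)
  obtain u' v' where gd: "g = (y, u', v', z)" using g by (auto simp: arrow_cat_def hom_def)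
  have a: "x \<in> Ar C" "y \<in> Ar C" "z \<in> Ar C" "Cmp C y u = Cmp C v x" "Cmp C z u' = Cmp C v' y"
    and h: "u \<in> hom C (Dom C x) (Dom C y)" "v \<in> hom C (Cod C x) (Cod C y)"
      "u' \<in> hom C (Dom C y) (Dom C z)" "v' \<in> hom C (Cod C y) (Cod C z)"
    using f g by (auto simp: arrow_cat_def hom_def fd gd)
  have m: "x \<in> hom C (Dom C x) (Cod C x)" "y \<in> hom C (Dom C y) (Cod C y)"
    "z \<in> hom C (Dom C z) (Cod C z)" using a by (auto simp: hom_def)
  have "Cmp C z (Cmp C u' u) = Cmp C (Cmp C v' v) x"
    using Cmp_assoc[OF h(1) h(3) m(3)] Cmp_assoc[OF h(1) m(2) h(4)] Cmp_assoc[OF m(1) h(2) h(4)] a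
    by simp
  then show "Cmp (arrow_cat C) g f \<in> hom (arrow_cat C) x z"
    using Cmp_hom[OF h(1) h(3)] Cmp_hom[OF h(2) h(4)] a
    by (simp add: arrow_cat_def hom_def fd gd)
qed (auto simp: arrow_cat_def hom_def intro: Cmp_assoc')

lemma cod_functor: "is_functor (arrow_cat C) C (cod_ftr C)"
  using category_axioms arrow_category
  by (auto simp: is_functor_def arrow_cat_def cod_ftr_def hom_def)

lemma postcomp_functor:
  assumes "p \<in> Ar C"
  shows "is_functor (slice_cat C (Dom C p)) (slice_cat C (Cod C p)) (postcomp_ftr C p)"
  using assms slice_category
  by (auto simp: is_functor_def slice_simps slice_Ar postcomp_ftr_def hom_def Cmp_assoc')

end

lemma is_functorD:
  assumes "is_functor C D F"
  shows "category C" "category D"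
    and "x \<in> Ob C \<Longrightarrow> Fo F x \<in> Ob D"
    and "f \<in> Ar C \<Longrightarrow> Fa F f \<in> Ar D"
    and "f \<in> Ar C \<Longrightarrow> Dom D (Fa F f) = Fo F (Dom C f)"
    and "f \<in> Ar C \<Longrightarrow> Cod D (Fa F f) = Fo F (Cod C f)"
    and "x \<in> Ob C \<Longrightarrow> Fa F (Ide C x) = Ide D (Fo F x)"
    and "\<lbrakk>f \<in> Ar C; g \<in> Ar C; Dom C g = Cod C f\<rbrakk>
           \<Longrightarrow> Fa F (Cmp C g f) = Cmp D (Fa F g) (Fa F f)"
  using assms by (auto simp: is_functor_def hom_def)

lemma comp_ftr_simps [simp]:
  "Fo (comp_ftr G F) x = Fo G (Fo F x)" "Fa (comp_ftr G F) f = Fa G (Fa F f)"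
  by (simp_all add: comp_ftr_def)

lemma id_ftr_simps [simp]: "Fo id_ftr x = x" "Fa id_ftr f = f"
  by (simp_all add: id_ftr_def)

lemma comp_functor:
  assumes "is_functor C D F" "is_functor D E G"
  shows "is_functor C E (comp_ftr G F)"
  using is_functorD[OF assms(1)] is_functorD[OF assms(2)] by (auto simp: is_functor_def hom_def)

lemma nat_transD:
  assumes "nat_trans C D F G \<tau>"
  shows "is_functor C D F" "is_functor C D G"
    and "x \<in> Ob C \<Longrightarrow> \<tau> x \<in> Ar D"
    and "x \<in> Ob C \<Longrightarrow> Dom D (\<tau> x) = Fo F x"
    and "x \<in> Ob C \<Longrightarrow> Cod D (\<tau> x) = Fo G x"
    and "f \<in> Ar C \<Longrightarrow> Cmp D (\<tau> (Cod C f)) (Fa F f) = Cmp D (Fa G f) (\<tau> (Dom C f))"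
  using assms by (auto simp: nat_trans_def hom_def)

lemma EM_category:
  assumes "is_monad C T \<eta> \<mu>"
  shows "category (EM_cat C T \<eta> \<mu>)"
proof -
  have T: "is_functor C C T" using assms by (auto simp: is_monad_def nat_trans_def)
  interpret category C using T by (simp add: is_functor_def)
  let ?E = "EM_cat C T \<eta> \<mu>"
  show ?thesis
  proof
    fix f x y g z
    assume f: "f \<in> hom ?E x y" and g: "g \<in> hom ?E y z"
    obtain x1 hx y1 hy z1 hz where xyz: "x = (x1, hx)" "y = (y1, hy)" "z = (z1, hz)"
      by (metis surj_pair)
    obtain u where fd: "f = (x, u, y)" using f by (auto simp: EM_cat_def hom_def)
    obtain v where gd: "g = (y, v, z)" using g by (auto simp: EM_cat_def hom_def)
    have a: "x \<in> EM_alg C T \<eta> \<mu>" "y \<in> EM_alg C T \<eta> \<mu>" "z \<in> EM_alg C T \<eta> \<mu>"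
      and u: "u \<in> hom C x1 y1" and v: "v \<in> hom C y1 z1"
      and e: "Cmp C u hx = Cmp C hy (Fa T u)" "Cmp C v hy = Cmp C hz (Fa T v)"
      using f g by (auto simp: EM_cat_def hom_def fd gd xyz)
    have h: "hx \<in> hom C (Fo T x1) x1" "hy \<in> hom C (Fo T y1) y1" "hz \<in> hom C (Fo T z1) z1"
      using a by (auto simp: EM_alg_def xyz)
    have Tu: "Fa T u \<in> hom C (Fo T x1) (Fo T y1)" and Tv: "Fa T v \<in> hom C (Fo T y1) (Fo T z1)"
      and Tvu: "Fa T (Cmp C v u) = Cmp C (Fa T v) (Fa T u)"
      using T u v by (auto simp: is_functor_def hom_def)
    have "Cmp C (Cmp C v u) hx = Cmp C hz (Fa T (Cmp C v u))"
      using Cmp_assoc[OF h(1) u v] Cmp_assoc[OF Tu h(2) v] Cmp_assoc[OF Tu Tv h(3)] e Tvu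
      by simp
    then show "Cmp ?E g f \<in> hom ?E x z"
      using Cmp_hom[OF u v] a by (simp add: EM_cat_def hom_def fd gd xyz)
  next
    fix x assume "x \<in> Ob ?E"
    then show "Ide ?E x \<in> hom ?E x x"
      by (auto simp: EM_cat_def EM_alg_def hom_def is_functorD[OF T])
  qed (auto simp: EM_cat_def EM_alg_def hom_def intro: Cmp_assoc')
qed

lemma adjunctionD:
  assumes "adjunction C D F U \<eta> \<epsilon>"
  shows "is_functor C D F" "is_functor D C U"
    and "nat_trans C C id_ftr (comp_ftr U F) \<eta>" "nat_trans D D (comp_ftr F U) id_ftr \<epsilon>"
    and "x \<in> Ob C \<Longrightarrow> Cmp D (\<epsilon> (Fo F x)) (Fa F (\<eta> x)) = Ide D (Fo F x)"
    and "y \<in> Ob D \<Longrightarrow> Cmp C (Fa U (\<epsilon> y)) (\<eta> (Fo U y)) = Ide C (Fo U y)"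
  using assms by (auto simp: adjunction_def)

lemma adjunction_counit:
  assumes "adjunction C D F U \<eta> \<epsilon>" and y: "y \<in> Ob D"
  shows "Cmp C (Fa U (\<epsilon> y)) (Fa U (Fa F (Fa U (\<epsilon> y))))
           = Cmp C (Fa U (\<epsilon> y)) (Fa U (\<epsilon> (Fo F (Fo U y))))"
proof -
  note A = adjunctionD[OF assms(1)]
  note F = is_functorD[OF A(1)] and U = is_functorD[OF A(2)] and E = nat_transD[OF A(4)]
  have "Cmp D (\<epsilon> y) (Fa F (Fa U (\<epsilon> y))) = Cmp D (\<epsilon> y) (\<epsilon> (Fo F (Fo U y)))"
    using E(6)[OF E(3)[OF y]] y by (simp add: E)
  from arg_cong[OF this, of "Fa U"] show ?thesis
    using y by (simp add: F U E)
qed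

lemma adjunction_monad:
  assumes "adjunction C D F U \<eta> \<epsilon>"
  shows "is_monad C (comp_ftr U F) \<eta> (\<lambda>x. Fa U (\<epsilon> (Fo F x)))"
proof -
  note A = adjunctionD[OF assms]
  note F = is_functorD[OF A(1)] and U = is_functorD[OF A(2)] and E = nat_transD[OF A(4)]
    and H = nat_transD[OF A(3)]
  interpret C: category C by (rule F)
  interpret D: category D by (rule F)
  have T: "is_functor C C (comp_ftr U F)" by (rule comp_functor[OF A(1,2)])
  have "Cmp C (Fa U (\<epsilon> (Fo F (Cod C f)))) (Fa U (Fa F (Fa U (Fa F f))))
          = Cmp C (Fa U (Fa F f)) (Fa U (\<epsilon> (Fo F (Dom C f))))" if f: "f \<in> Ar C" for f
    using arg_cong[OF E(6)[OF F(4)[OF f]], of "Fa U"] f by (simp add: F U E)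
  then have "nat_trans C C (comp_ftr (comp_ftr U F) (comp_ftr U F)) (comp_ftr U F)
               (\<lambda>x. Fa U (\<epsilon> (Fo F x)))"
    using T comp_functor[OF T T] by (auto simp: nat_trans_def hom_def F U E)
  moreover have "Cmp C (Fa U (\<epsilon> (Fo F x))) (Fa U (Fa F (\<eta> x))) = Ide C (Fo U (Fo F x))"
    if x: "x \<in> Ob C" for x
    using arg_cong[OF A(5)[OF x], of "Fa U"] x by (simp add: F U E H)
  ultimately show ?thesis
    using A(3) by (auto simp: is_monad_def A(6) F U E H adjunction_counit[OF assms])
qed

lemma comparison_functor:
  assumes "adjunction C D F U \<eta> \<epsilon>"
  shows "is_functor D (adj_EM_cat C F U \<eta> \<epsilon>) (comparison_ftr D U \<epsilon>)"
proof -
  note A = adjunctionD[OF assms]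
  note F = is_functorD[OF A(1)] and U = is_functorD[OF A(2)] and E = nat_transD[OF A(4)]
  interpret D: category D by (rule F)
  have alg: "(Fo U y, Fa U (\<epsilon> y)) \<in> EM_alg C (comp_ftr U F) \<eta> (\<lambda>x. Fa U (\<epsilon> (Fo F x)))"
    if "y \<in> Ob D" for y
    using that adjunction_counit[OF assms that] by (simp add: EM_alg_def hom_def A(6) F U E)
  have "Cmp C (Fa U g) (Fa U (\<epsilon> (Dom D g))) = Cmp C (Fa U (\<epsilon> (Cod D g))) (Fa U (Fa F (Fa U g)))"
    if g: "g \<in> Ar D" for g
    using arg_cong[OF E(6)[OF g], of "Fa U"] g by (simp add: F U E)
  then show ?thesis
    using EM_category[OF adjunction_monad[OF assms]] F(2) alg
    by (auto simp: is_functor_def adj_EM_cat_def comparison_ftr_def EM_cat_def hom_def U)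
qed

end

theory Submission
  imports Defs
begin

text \<open>Let \<open>z\<close> be a strict initial object of \<open>A\<close>. Sending \<open>x\<close> to the unique arrow \<open>z \<rightarrow> x\<close> embeds \<open>A\<close>
  into its arrow category as a coreflective subcategory, and the coreflector is the codomain
  functor. By strictness this subcategory is a sieve up to isomorphism: if an arrow \<open>f\<close> has a
  morphism to some \<open>z \<rightarrow> x\<close>, then the domain of \<open>f\<close> maps to \<open>z\<close>, hence is initial, and the
  coreflection counit at \<open>f\<close> is invertible. The
  theorem is thus an instance of a general fact: the coreflector \<open>R\<close> of every coreflective subcategory
  \<open>L : B \<rightarrow> X\<close> which is a sieve in this sense preserves effective descent morphisms
  (\<open>R_preserves_effective_descent\<close>).

  Let \<open>p : f \<rightarrow> g\<close> be of effective descent in \<open>X\<close>. The pullback of \<open>R p\<close> along \<open>w : c \<rightarrow> R g\<close> is the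
  image under the right adjoint \<open>R\<close> of the pullback of \<open>p\<close> along the transpose \<open>L c \<rightarrow> g\<close> of \<open>w\<close>
  (\<open>R_has_pullbacks_along\<close>).

  For monadicity, the coreflection passes to the slices, so that \<open>B \<down> R f\<close> and \<open>B \<down> R g\<close> become
  coreflective in \<open>X \<down> f\<close> and \<open>X \<down> g\<close>, and \<open>p\<^sub>!\<close> commutes with the inclusions, with the coreflectors
  and with the counits. Therefore \<open>R p\<^sup>* L\<close> is right adjoint to \<open>(R p)\<^sub>!\<close>. The sieve property says that
  \<open>p\<^sup>*\<close> sends the subcategory of \<open>X \<down> g\<close> into that of \<open>X \<down> f\<close>: the pullback of an object
  of the sieve maps to that object. On such objects \<open>R\<close> is faithful and full, so descent data and
  their morphisms in \<open>B\<close> lift to \<open>X\<close>, where they are effective; applying \<open>R\<close> to the descended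
  object gives one in \<open>B\<close>, because \<open>R p\<^sup>*\<close> inverts the counit of the coreflection. This is carried out
  for abstract adjunctions between coreflective subcategories in the locale
  \<open>adjunction_over_coreflections\<close>, with the result \<open>monadic_restricts\<close>, and with monadicity expressed
  by lifting conditions on algebras and their maps (\<open>monadic_adjunction_iff\<close>).\<close>

section \<open>Isomorphisms\<close>

lemma iso_arr_inverse:
  assumes "iso_arr C f"
  obtains g where "g \<in> Ar C" "Dom C g = Cod C f" "Cod C g = Dom C f"
    "g \<cdot>\<^bsub>C\<^esub> f = Ide C (Dom C f)" "f \<cdot>\<^bsub>C\<^esub> g = Ide C (Cod C f)"
  using assms unfolding iso_arr_def hom_def by auto

lemma iso_arrI:
  assumes "f \<in> Ar C" "g \<in> Ar C" "Dom C g = Cod C f" "Cod C g = Dom C f"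
    "g \<cdot>\<^bsub>C\<^esub> f = Ide C (Dom C f)" "f \<cdot>\<^bsub>C\<^esub> g = Ide C (Cod C f)"
  shows "iso_arr C f"
  using assms unfolding iso_arr_def hom_def by auto

lemma iso_arr_in_Ar: "iso_arr C f \<Longrightarrow> f \<in> Ar C"
  by (simp add: iso_arr_def)

context category
begin

lemma iso_arr_cancel_left:
  assumes e: "iso_arr C e" and fg: "f \<in> Ar C" "g \<in> Ar C" "Cod C f = Dom C e" "Cod C g = Dom C e"
    and eq: "e \<cdot> f = e \<cdot> g"
  shows "f = g"
proof -
  obtain d where d: "d \<in> Ar C" "Dom C d = Cod C e" "Cod C d = Dom C e"
    "d \<cdot> e = Ide C (Dom C e)" "e \<cdot> d = Ide C (Cod C e)"
    by (rule iso_arr_inverse[OF e])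
  have "d \<cdot> (e \<cdot> f) = f" "d \<cdot> (e \<cdot> g) = g"
    using iso_arr_in_Ar[OF e] d fg by (simp_all add: Cmp_assoc')
  then show ?thesis unfolding eq by (rule trans[OF sym])
qed

lemma iso_arr_cancel_right:
  assumes e: "iso_arr C e" and fg: "f \<in> Ar C" "g \<in> Ar C" "Dom C f = Cod C e" "Dom C g = Cod C e"
    and eq: "f \<cdot> e = g \<cdot> e"
  shows "f = g"
proof -
  obtain d where d: "d \<in> Ar C" "Dom C d = Cod C e" "Cod C d = Dom C e"
    "d \<cdot> e = Ide C (Dom C e)" "e \<cdot> d = Ide C (Cod C e)"
    by (rule iso_arr_inverse[OF e])
  have "(f \<cdot> e) \<cdot> d = f" "(g \<cdot> e) \<cdot> d = g"
    using iso_arr_in_Ar[OF e] d fg by (simp_all add: Cmp_assoc'[symmetric])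
  then show ?thesis unfolding eq by (rule trans[OF sym])
qed

lemma iso_arr_Cmp:
  assumes f: "iso_arr C f" and g: "iso_arr C g" and fg: "Dom C g = Cod C f"
  shows "iso_arr C (g \<cdot> f)"
proof -
  note fA = iso_arr_in_Ar[OF f] and gA = iso_arr_in_Ar[OF g]
  obtain f' where f': "f' \<in> Ar C" "Dom C f' = Cod C f" "Cod C f' = Dom C f"
    "f' \<cdot> f = Ide C (Dom C f)" "f \<cdot> f' = Ide C (Cod C f)"
    by (rule iso_arr_inverse[OF f])
  obtain g' where g': "g' \<in> Ar C" "Dom C g' = Cod C g" "Cod C g' = Dom C g"
    "g' \<cdot> g = Ide C (Dom C g)" "g \<cdot> g' = Ide C (Cod C g)"
    by (rule iso_arr_inverse[OF g])
  have "(f' \<cdot> g') \<cdot> (g \<cdot> f) = f' \<cdot> ((g' \<cdot> g) \<cdot> f)"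
    using fA gA f'(1-3) g'(1-3) fg by (simp add: Cmp_assoc')
  then have 1: "(f' \<cdot> g') \<cdot> (g \<cdot> f) = Ide C (Dom C f)"
    using fA f' g' fg by simp
  have "(g \<cdot> f) \<cdot> (f' \<cdot> g') = g \<cdot> ((f \<cdot> f') \<cdot> g')"
    using fA gA f'(1-3) g'(1-3) fg by (simp add: Cmp_assoc')
  then have 2: "(g \<cdot> f) \<cdot> (f' \<cdot> g') = Ide C (Cod C g)"
    using gA f' g' fg by simp
  show ?thesis
    by (rule iso_arrI[of _ _ "f' \<cdot> g'"]) (use fA gA f' g' fg 1 2 in simp_all)
qed

end

lemma functor_iso_arr:
  assumes F: "is_functor C D F" and f: "iso_arr C f"
  shows "iso_arr D (Fa F f)"
proof -
  note F' = is_functorD[OF F]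
  interpret C: category C by (rule F')
  obtain g where g: "g \<in> Ar C" "Dom C g = Cod C f" "Cod C g = Dom C f"
    "g \<cdot>\<^bsub>C\<^esub> f = Ide C (Dom C f)" "f \<cdot>\<^bsub>C\<^esub> g = Ide C (Cod C f)"
    by (rule iso_arr_inverse[OF f])
  note fA = iso_arr_in_Ar[OF f]
  have "Fa F g \<cdot>\<^bsub>D\<^esub> Fa F f = Ide D (Fo F (Dom C f))" "Fa F f \<cdot>\<^bsub>D\<^esub> Fa F g = Ide D (Fo F (Cod C f))"
    using F'(8)[of f g] F'(8)[of g f] g fA by (simp_all add: F'(7))
  then show ?thesis
    by (intro iso_arrI[of _ _ "Fa F g"]) (use g fA in \<open>simp_all add: F'\<close>)
qed

section \<open>Equivalences as fully faithful and essentially surjective functors\<close>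

definition fully_faithful ::
    "('o, 'm) cat \<Rightarrow> ('p, 'n) cat \<Rightarrow> ('o, 'm, 'p, 'n) ftr \<Rightarrow> bool" where
  "fully_faithful C D F \<longleftrightarrow> is_functor C D F \<and>
     (\<forall>x \<in> Ob C. \<forall>y \<in> Ob C. \<forall>k \<in> hom D (Fo F x) (Fo F y). \<exists>!f. f \<in> hom C x y \<and> Fa F f = k)"

definition essentially_surjective ::
    "('o, 'm) cat \<Rightarrow> ('p, 'n) cat \<Rightarrow> ('o, 'm, 'p, 'n) ftr \<Rightarrow> bool" where
  "essentially_surjective C D F \<longleftrightarrow> (\<forall>y \<in> Ob D. \<exists>x \<in> Ob C. isomorphic D (Fo F x) y)"

text \<open>Naturality of an invertible unit exhibits each arrow \<open>f\<close> as a conjugate of \<open>G (F f)\<close>, which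
  only depends on \<open>F f\<close>.\<close>

lemma faithful_if_unit_iso:
  assumes F: "is_functor C D F" and G: "is_functor D C G"
    and \<alpha>: "nat_iso C C id_ftr (comp_ftr G F) \<alpha>"
    and fg: "f \<in> hom C x y" "g \<in> hom C x y" "Fa F f = Fa F g"
  shows "f = g"
proof -
  interpret C: category C by (rule is_functorD[OF F])
  have nt: "nat_trans C C id_ftr (comp_ftr G F) \<alpha>" and iso: "iso_arr C (\<alpha> y)"
    using \<alpha> fg(1) by (auto simp: nat_iso_def hom_def)
  note N = nat_transD[OF nt]
  have y: "y \<in> Ob C" using fg(1) by (auto simp: hom_def)
  have "\<alpha> y \<cdot>\<^bsub>C\<^esub> f = \<alpha> y \<cdot>\<^bsub>C\<^esub> g"
    using N(6)[of f] N(6)[of g] fg by (simp add: hom_def)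
  then show ?thesis
    using C.iso_arr_cancel_left[OF iso] fg N(4)[OF y] by (simp add: hom_def)
qed

lemma faithful_if_counit_iso:
  assumes F: "is_functor C D F" and G: "is_functor D C G"
    and \<beta>: "nat_iso D D (comp_ftr F G) id_ftr \<beta>"
    and fg: "f \<in> hom D x y" "g \<in> hom D x y" "Fa G f = Fa G g"
  shows "f = g"
proof -
  interpret D: category D by (rule is_functorD[OF F])
  have nt: "nat_trans D D (comp_ftr F G) id_ftr \<beta>" and iso: "iso_arr D (\<beta> x)"
    using \<beta> fg(1) by (auto simp: nat_iso_def hom_def)
  note N = nat_transD[OF nt]
  have x: "x \<in> Ob D" using fg(1) by (auto simp: hom_def)
  have "f \<cdot>\<^bsub>D\<^esub> \<beta> x = g \<cdot>\<^bsub>D\<^esub> \<beta> x"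
    using N(6)[of f] N(6)[of g] fg by (simp add: hom_def)
  then show ?thesis
    using D.iso_arr_cancel_right[OF iso] fg N(5)[OF x] by (simp add: hom_def)
qed

text \<open>Fullness needs both isomorphisms: the unit suggests the preimage, and faithfulness of the
  inverse functor, which comes from the counit, shows that it is one.\<close>

lemma equivalence_fully_faithful:
  assumes "is_equivalence C D F"
  shows "fully_faithful C D F"
proof -
  obtain G \<alpha> \<beta> where F: "is_functor C D F" and G: "is_functor D C G"
    and \<alpha>: "nat_iso C C id_ftr (comp_ftr G F) \<alpha>" and \<beta>: "nat_iso D D (comp_ftr F G) id_ftr \<beta>"
    using assms unfolding is_equivalence_def by blast
  note F' = is_functorD[OF F] and G' = is_functorD[OF G]
  interpret C: category C by (rule F')
  interpret D: category D by (rule F')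
  have nt: "nat_trans C C id_ftr (comp_ftr G F) \<alpha>" and iso: "\<And>x. x \<in> Ob C \<Longrightarrow> iso_arr C (\<alpha> x)"
    using \<alpha> by (auto simp: nat_iso_def)
  note N = nat_transD[OF nt]
  have "\<exists>f. f \<in> hom C x y \<and> Fa F f = k"
    if x: "x \<in> Ob C" and y: "y \<in> Ob C" and k: "k \<in> hom D (Fo F x) (Fo F y)" for x y k
  proof -
    obtain a where a: "a \<in> Ar C" "Dom C a = Fo G (Fo F y)" "Cod C a = y"
      "a \<cdot>\<^bsub>C\<^esub> \<alpha> y = Ide C y" "\<alpha> y \<cdot>\<^bsub>C\<^esub> a = Ide C (Fo G (Fo F y))"
      using iso_arr_inverse[OF iso[OF y]] N(4,5)[OF y] by auto
    have kA: "k \<in> Ar D" "Dom D k = Fo F x" "Cod D k = Fo F y" using k by (auto simp: hom_def)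
    define f where "f = a \<cdot>\<^bsub>C\<^esub> (Fa G k \<cdot>\<^bsub>C\<^esub> \<alpha> x)"
    have f: "f \<in> Ar C" "Dom C f = x" "Cod C f = y"
      using a kA x y by (simp_all add: f_def N G')
    have "\<alpha> y \<cdot>\<^bsub>C\<^esub> f = (\<alpha> y \<cdot>\<^bsub>C\<^esub> a) \<cdot>\<^bsub>C\<^esub> (Fa G k \<cdot>\<^bsub>C\<^esub> \<alpha> x)"
      unfolding f_def by (rule C.Cmp_assoc') (use a kA x y in \<open>simp_all add: N G'\<close>)
    then have "\<alpha> y \<cdot>\<^bsub>C\<^esub> f = Fa G k \<cdot>\<^bsub>C\<^esub> \<alpha> x"
      using a kA x y by (simp add: N G')
    then have "Fa G (Fa F f) \<cdot>\<^bsub>C\<^esub> \<alpha> x = Fa G k \<cdot>\<^bsub>C\<^esub> \<alpha> x"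
      using N(6)[OF f(1)] f by simp
    then have "Fa G (Fa F f) = Fa G k"
      by (rule C.iso_arr_cancel_right[OF iso[OF x], rotated -1])
        (use f kA x in \<open>simp_all add: N G' F'\<close>)
    then have "Fa F f = k"
      by (intro faithful_if_counit_iso[OF F G \<beta>, of _ "Fo F x" "Fo F y"])
        (use f kA in \<open>simp_all add: hom_def F'\<close>)
    then show ?thesis using f by (auto simp: hom_def)
  qed
  then show ?thesis
    unfolding fully_faithful_def using F faithful_if_unit_iso[OF F G \<alpha>] by blast
qed

lemma equivalence_essentially_surjective:
  assumes "is_equivalence C D F"
  shows "essentially_surjective C D F"
proof -
  obtain G \<beta> where G: "is_functor D C G" and \<beta>: "nat_iso D D (comp_ftr F G) id_ftr \<beta>"
    using assms unfolding is_equivalence_def by blast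
  then have "\<beta> y \<in> hom D (Fo F (Fo G y)) y \<and> iso_arr D (\<beta> y)" if "y \<in> Ob D" for y
    using that by (simp add: nat_iso_def nat_trans_def)
  then show ?thesis
    unfolding essentially_surjective_def isomorphic_def using is_functorD(3)[OF G] by blast
qed

text \<open>The inverse functor picks a preimage \<open>X y\<close> of each object up to isomorphism and transports
  arrows along the chosen isomorphisms.\<close>

lemma equivalenceI:
  assumes ff: "fully_faithful C D F" and es: "essentially_surjective C D F"
  shows "is_equivalence C D F"
proof -
  have F: "is_functor C D F" using ff by (simp add: fully_faithful_def)
  note F' = is_functorD[OF F]
  interpret C: category C by (rule F')
  interpret D: category D by (rule F')
  have "\<forall>y \<in> Ob D. \<exists>x b. x \<in> Ob C \<and> b \<in> hom D (Fo F x) y \<and> iso_arr D b"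
    using es unfolding essentially_surjective_def isomorphic_def by blast
  then obtain X b where X: "\<And>y. y \<in> Ob D \<Longrightarrow> X y \<in> Ob C"
    and b: "\<And>y. y \<in> Ob D \<Longrightarrow> b y \<in> hom D (Fo F (X y)) y" "\<And>y. y \<in> Ob D \<Longrightarrow> iso_arr D (b y)"
    by metis
  have bA: "b y \<in> Ar D" "Dom D (b y) = Fo F (X y)" "Cod D (b y) = y" if "y \<in> Ob D" for y
    using b(1)[OF that] by (auto simp: hom_def)
  have "\<exists>c. c \<in> Ar D \<and> Dom D c = y \<and> Cod D c = Fo F (X y) \<and> c \<cdot>\<^bsub>D\<^esub> b y = Ide D (Fo F (X y))
          \<and> b y \<cdot>\<^bsub>D\<^esub> c = Ide D y" if "y \<in> Ob D" for y
    using iso_arr_inverse[OF b(2)[OF that]] bA[OF that] by metis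
  then obtain c where c: "\<And>y. y \<in> Ob D \<Longrightarrow> c y \<in> Ar D" "\<And>y. y \<in> Ob D \<Longrightarrow> Dom D (c y) = y"
    "\<And>y. y \<in> Ob D \<Longrightarrow> Cod D (c y) = Fo F (X y)"
    "\<And>y. y \<in> Ob D \<Longrightarrow> c y \<cdot>\<^bsub>D\<^esub> b y = Ide D (Fo F (X y))"
    "\<And>y. y \<in> Ob D \<Longrightarrow> b y \<cdot>\<^bsub>D\<^esub> c y = Ide D y" by metis
  define lift where "lift x y k = (THE f. f \<in> hom C x y \<and> Fa F f = k)" for x y k
  have lift: "lift x y k \<in> hom C x y \<and> Fa F (lift x y k) = k"
    if "x \<in> Ob C" "y \<in> Ob C" "k \<in> Ar D" "Dom D k = Fo F x" "Cod D k = Fo F y" for x y k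
    unfolding lift_def by (rule theI') (use ff that in \<open>auto simp: fully_faithful_def hom_def\<close>)
  then have liftA: "lift x y k \<in> Ar C" "Dom C (lift x y k) = x" "Cod C (lift x y k) = y"
      "Fa F (lift x y k) = k"
    if "x \<in> Ob C" "y \<in> Ob C" "k \<in> Ar D" "Dom D k = Fo F x" "Cod D k = Fo F y" for x y k
    using that by (auto simp: hom_def)
  have eqI: "f = g" if "f \<in> Ar C" "g \<in> Ar C" "Dom C f = Dom C g" "Cod C f = Cod C g"
      "Fa F f = Fa F g" for f g
  proof -
    have "\<exists>!h. h \<in> hom C (Dom C f) (Cod C f) \<and> Fa F h = Fa F f"
      using ff that(1) F' unfolding fully_faithful_def by (simp add: hom_def)
    then show ?thesis using that unfolding hom_def by (metis (mono_tags, lifting) mem_Collect_eq)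
  qed
  \<comment> \<open>\<open>e k\<close> is \<open>k\<close> conjugated by the chosen isomorphisms, so it is an arrow between objects
    in the image of \<open>F\<close> and can be lifted.\<close>
  define e where "e k = c (Cod D k) \<cdot>\<^bsub>D\<^esub> (k \<cdot>\<^bsub>D\<^esub> b (Dom D k))" for k
  have e: "e k \<in> Ar D" "Dom D (e k) = Fo F (X (Dom D k))" "Cod D (e k) = Fo F (X (Cod D k))"
    if "k \<in> Ar D" for k
    using that by (simp_all add: e_def bA c)
  have be: "b (Cod D k) \<cdot>\<^bsub>D\<^esub> e k = k \<cdot>\<^bsub>D\<^esub> b (Dom D k)" if "k \<in> Ar D" for k
  proof -
    have "b (Cod D k) \<cdot>\<^bsub>D\<^esub> e k = (b (Cod D k) \<cdot>\<^bsub>D\<^esub> c (Cod D k)) \<cdot>\<^bsub>D\<^esub> (k \<cdot>\<^bsub>D\<^esub> b (Dom D k))"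
      unfolding e_def by (rule D.Cmp_assoc') (use that in \<open>simp_all add: bA c\<close>)
    then show ?thesis using that by (simp add: bA c)
  qed
  define G where "G = \<lparr>Fo = X, Fa = (\<lambda>k. lift (X (Dom D k)) (X (Cod D k)) (e k))\<rparr>"
  have GO: "Fo G y = X y" for y by (simp add: G_def)
  have GA: "Fa G k \<in> Ar C" "Dom C (Fa G k) = X (Dom D k)" "Cod C (Fa G k) = X (Cod D k)"
    "Fa F (Fa G k) = e k" if "k \<in> Ar D" for k
    using that by (simp_all add: G_def liftA X e)
  have e_Cmp: "e (l \<cdot>\<^bsub>D\<^esub> k) = e l \<cdot>\<^bsub>D\<^esub> e k" if "k \<in> Ar D" "l \<in> Ar D" "Cod D k = Dom D l" for k l
  proof (rule D.iso_arr_cancel_left[OF b(2)[of "Cod D l"]])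
    have "b (Cod D l) \<cdot>\<^bsub>D\<^esub> (e l \<cdot>\<^bsub>D\<^esub> e k) = (b (Cod D l) \<cdot>\<^bsub>D\<^esub> e l) \<cdot>\<^bsub>D\<^esub> e k"
      by (rule D.Cmp_assoc') (use that in \<open>simp_all add: bA e\<close>)
    also have "\<dots> = l \<cdot>\<^bsub>D\<^esub> (b (Dom D l) \<cdot>\<^bsub>D\<^esub> e k)"
      using that by (simp add: be) (rule D.Cmp_assoc'[symmetric]; use that in \<open>simp add: bA e\<close>)
    also have "\<dots> = l \<cdot>\<^bsub>D\<^esub> (k \<cdot>\<^bsub>D\<^esub> b (Dom D k))"
      using that be[of k] by simp
    also have "\<dots> = (l \<cdot>\<^bsub>D\<^esub> k) \<cdot>\<^bsub>D\<^esub> b (Dom D k)"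
      by (rule D.Cmp_assoc') (use that in \<open>simp_all add: bA\<close>)
    finally show "b (Cod D l) \<cdot>\<^bsub>D\<^esub> e (l \<cdot>\<^bsub>D\<^esub> k) = b (Cod D l) \<cdot>\<^bsub>D\<^esub> (e l \<cdot>\<^bsub>D\<^esub> e k)"
      using be[of "l \<cdot>\<^bsub>D\<^esub> k"] that by simp
  qed (use that in \<open>simp_all add: bA e\<close>)
  have G: "is_functor D C G"
    unfolding is_functor_def
  proof (intro conjI ballI impI)
    fix k l assume kl: "k \<in> Ar D" "l \<in> Ar D" "Cod D k = Dom D l"
    show "Fa G (l \<cdot>\<^bsub>D\<^esub> k) = Fa G l \<cdot>\<^bsub>C\<^esub> Fa G k"
      by (rule eqI) (use kl in \<open>simp_all add: GA F' e_Cmp\<close>)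
  next
    fix y assume y: "y \<in> Ob D"
    show "Fa G (Ide D y) = Ide C (Fo G y)"
      by (rule eqI) (use y in \<open>simp_all add: GA GO F' X, simp add: e_def bA c\<close>)
  qed (simp_all add: GO X GA hom_def F')
  have \<beta>: "nat_iso D D (comp_ftr F G) id_ftr b"
    unfolding nat_iso_def nat_trans_def
    using comp_functor[OF G F] D.category_axioms b
    by (auto simp: GO GA be is_functor_def hom_def)
  \<comment> \<open>The unit is the lift of the inverse of \<open>b\<close>, the counit being \<open>b\<close> itself.\<close>
  define a where "a x = lift x (X (Fo F x)) (c (Fo F x))" for x
  have aA: "a x \<in> Ar C" "Dom C (a x) = x" "Cod C (a x) = X (Fo F x)" "Fa F (a x) = c (Fo F x)"
    if "x \<in> Ob C" for x using that by (simp_all add: a_def liftA X F' c)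
  have a_nat: "a (Cod C f) \<cdot>\<^bsub>C\<^esub> f = Fa G (Fa F f) \<cdot>\<^bsub>C\<^esub> a (Dom C f)" if f: "f \<in> Ar C" for f
  proof (rule eqI)
    let ?c = "c (Fo F (Dom C f))" and ?d = "c (Fo F (Cod C f))" and ?b = "b (Fo F (Dom C f))"
    have "e (Fa F f) \<cdot>\<^bsub>D\<^esub> ?c = ?d \<cdot>\<^bsub>D\<^esub> (Fa F f \<cdot>\<^bsub>D\<^esub> (?b \<cdot>\<^bsub>D\<^esub> ?c))"
      unfolding e_def using f by (simp add: F' bA c D.Cmp_assoc'[symmetric])
    also have "\<dots> = ?d \<cdot>\<^bsub>D\<^esub> Fa F f" using f by (simp add: F' c)
    finally show "Fa F (a (Cod C f) \<cdot>\<^bsub>C\<^esub> f) = Fa F (Fa G (Fa F f) \<cdot>\<^bsub>C\<^esub> a (Dom C f))"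
      using f by (simp add: F' GA aA)
  qed (use f in \<open>simp_all add: aA GA F'\<close>)
  have a_iso: "iso_arr C (a x)" if x: "x \<in> Ob C" for x
  proof -
    let ?a' = "lift (X (Fo F x)) x (b (Fo F x))"
    have a': "?a' \<in> Ar C" "Dom C ?a' = X (Fo F x)" "Cod C ?a' = x" "Fa F ?a' = b (Fo F x)"
      using x by (simp_all add: liftA X F' bA)
    show ?thesis
    proof (rule iso_arrI[of _ _ ?a'])
      show "?a' \<cdot>\<^bsub>C\<^esub> a x = Ide C (Dom C (a x))"
        by (rule eqI) (use x in \<open>simp_all add: aA a' F' c\<close>)
      show "a x \<cdot>\<^bsub>C\<^esub> ?a' = Ide C (Cod C (a x))"
        by (rule eqI) (use x in \<open>simp_all add: aA a' F' c X\<close>)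
    qed (use x in \<open>simp_all add: aA a'\<close>)
  qed
  have "nat_iso C C id_ftr (comp_ftr G F) a"
    unfolding nat_iso_def nat_trans_def
    using comp_functor[OF F G] C.category_axioms a_iso
    by (auto simp: GO aA a_nat is_functor_def hom_def)
  then show ?thesis unfolding is_equivalence_def using F G \<beta> by blast
qed

section \<open>Monadicity in elementary terms\<close>

lemma EM_Ar:
  "(a, f, b) \<in> Ar (EM_cat C T \<eta> \<mu>) \<longleftrightarrow> a \<in> EM_alg C T \<eta> \<mu> \<and> b \<in> EM_alg C T \<eta> \<mu> \<and>
     f \<in> hom C (fst a) (fst b) \<and> f \<cdot>\<^bsub>C\<^esub> snd a = snd b \<cdot>\<^bsub>C\<^esub> Fa T f"
  by (cases a; cases b) (auto simp: EM_cat_def)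

lemma EM_simps:
  "Ob (EM_cat C T \<eta> \<mu>) = EM_alg C T \<eta> \<mu>"
  "Dom (EM_cat C T \<eta> \<mu>) (a, f, b) = a"
  "Cod (EM_cat C T \<eta> \<mu>) (a, f, b) = b"
  "Ide (EM_cat C T \<eta> \<mu>) a = (a, Ide C (fst a), a)"
  "Cmp (EM_cat C T \<eta> \<mu>) (b', g, c) (a, f, b) = (a, g \<cdot>\<^bsub>C\<^esub> f, c)"
  by (auto simp: EM_cat_def split: prod.split)

text \<open>The inverse of an invertible algebra map is again an algebra map, so the forgetful functor
  from algebras reflects isomorphisms.\<close>

lemma EM_iso_arr_iff:
  assumes T: "is_functor C C T"
  shows "iso_arr (EM_cat C T \<eta> \<mu>) (a, f, b) \<longleftrightarrow>
    (a, f, b) \<in> Ar (EM_cat C T \<eta> \<mu>) \<and> iso_arr C f" (is "iso_arr ?E _ \<longleftrightarrow> _")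
proof
  assume L: "iso_arr ?E (a, f, b)"
  note A = iso_arr_in_Ar[OF L]
  obtain g where g: "g \<in> Ar ?E" "Dom ?E g = b" "Cod ?E g = a"
    "Cmp ?E g (a, f, b) = (a, Ide C (fst a), a)" "Cmp ?E (a, f, b) g = (b, Ide C (fst b), b)"
    by (rule iso_arr_inverse[OF L, unfolded EM_simps])
  obtain g' where gd: "g = (b, g', a)" using g(2,3) by (cases g) (simp add: EM_simps)
  have "iso_arr C f"
    by (rule iso_arrI[of _ _ g']) (use A g in \<open>auto simp: gd EM_Ar EM_simps hom_def\<close>)
  with A show "(a, f, b) \<in> Ar ?E \<and> iso_arr C f" by simp
next
  note T' = is_functorD[OF T]
  interpret category C by (rule T')
  assume "(a, f, b) \<in> Ar ?E \<and> iso_arr C f"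
  then have A: "(a, f, b) \<in> Ar ?E" and i: "iso_arr C f" by auto
  obtain g where g: "g \<in> Ar C" "Dom C g = Cod C f" "Cod C g = Dom C f"
    "g \<cdot>\<^bsub>C\<^esub> f = Ide C (Dom C f)" "f \<cdot>\<^bsub>C\<^esub> g = Ide C (Cod C f)"
    by (rule iso_arr_inverse[OF i])
  obtain x h y k where ab: "a = (x, h)" "b = (y, k)" by (metis surj_pair)
  have f: "f \<in> Ar C" "Dom C f = x" "Cod C f = y" "f \<cdot>\<^bsub>C\<^esub> h = k \<cdot>\<^bsub>C\<^esub> Fa T f"
    and h: "h \<in> Ar C" "Dom C h = Fo T x" "Cod C h = x"
    and k: "k \<in> Ar C" "Dom C k = Fo T y" "Cod C k = y"
    and xy: "x \<in> Ob C" "y \<in> Ob C"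
    using A by (auto simp: ab EM_Ar hom_def EM_alg_def)
  have 1: "f \<cdot>\<^bsub>C\<^esub> (g \<cdot>\<^bsub>C\<^esub> k) = k"
    using f g k by (simp add: Cmp_assoc')
  have "f \<cdot>\<^bsub>C\<^esub> (h \<cdot>\<^bsub>C\<^esub> Fa T g) = (f \<cdot>\<^bsub>C\<^esub> h) \<cdot>\<^bsub>C\<^esub> Fa T g"
    by (rule Cmp_assoc') (use f g h in \<open>simp_all add: T'\<close>)
  also have "\<dots> = k \<cdot>\<^bsub>C\<^esub> (Fa T f \<cdot>\<^bsub>C\<^esub> Fa T g)"
    unfolding f(4) by (rule Cmp_assoc'[symmetric]) (use f g k in \<open>simp_all add: T'\<close>)
  also have "Fa T f \<cdot>\<^bsub>C\<^esub> Fa T g = Ide C (Fo T y)"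
    using T'(8)[of g f] g f xy by (simp add: T'(7))
  finally have 2: "f \<cdot>\<^bsub>C\<^esub> (h \<cdot>\<^bsub>C\<^esub> Fa T g) = k" using k by simp
  have "g \<cdot>\<^bsub>C\<^esub> k = h \<cdot>\<^bsub>C\<^esub> Fa T g"
    by (rule iso_arr_cancel_left[OF i _ _ _ _ trans[OF 1 2[symmetric]]])
      (use f g h k in \<open>simp_all add: T'\<close>)
  then have "(b, g, a) \<in> Ar ?E"
    using A f g by (auto simp: EM_Ar hom_def ab)
  then show "iso_arr ?E (a, f, b)"
    by (intro iso_arrI[of _ _ "(b, g, a)"]) (use A f g in \<open>auto simp: EM_simps ab\<close>)
qed

text \<open>The next two conditions express that the comparison functor is fully faithful and that it
  is essentially surjective, without the tuples that encode algebras and their maps.\<close>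

definition algebra_maps_lift_uniquely ::
    "('o, 'm) cat \<Rightarrow> ('p, 'n) cat \<Rightarrow> ('o, 'm, 'p, 'n) ftr \<Rightarrow> ('p, 'n, 'o, 'm) ftr
       \<Rightarrow> ('p \<Rightarrow> 'n) \<Rightarrow> bool" where
  "algebra_maps_lift_uniquely C D F U \<epsilon> \<longleftrightarrow>
     (\<forall>y \<in> Ob D. \<forall>y' \<in> Ob D. \<forall>m \<in> hom C (Fo U y) (Fo U y').
        m \<cdot>\<^bsub>C\<^esub> Fa U (\<epsilon> y) = Fa U (\<epsilon> y') \<cdot>\<^bsub>C\<^esub> Fa U (Fa F m) \<longrightarrow>
        (\<exists>!n. n \<in> hom D y y' \<and> Fa U n = m))"

definition algebras_lift ::
    "('o, 'm) cat \<Rightarrow> ('p, 'n) cat \<Rightarrow> ('o, 'm, 'p, 'n) ftr \<Rightarrow> ('p, 'n, 'o, 'm) ftr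
       \<Rightarrow> ('o \<Rightarrow> 'm) \<Rightarrow> ('p \<Rightarrow> 'n) \<Rightarrow> bool" where
  "algebras_lift C D F U \<eta> \<epsilon> \<longleftrightarrow>
     (\<forall>(x, h) \<in> EM_alg C (comp_ftr U F) \<eta> (\<lambda>x. Fa U (\<epsilon> (Fo F x))).
        \<exists>y \<in> Ob D. \<exists>\<phi> \<in> hom C (Fo U y) x. iso_arr C \<phi> \<and>
          \<phi> \<cdot>\<^bsub>C\<^esub> Fa U (\<epsilon> y) = h \<cdot>\<^bsub>C\<^esub> Fa U (Fa F \<phi>))"

lemma comparison_fully_faithful_iff:
  assumes adj: "adjunction C D F U \<eta> \<epsilon>"
  shows "fully_faithful D (adj_EM_cat C F U \<eta> \<epsilon>) (comparison_ftr D U \<epsilon>) \<longleftrightarrow>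
    algebra_maps_lift_uniquely C D F U \<epsilon>" (is "fully_faithful D ?E ?K \<longleftrightarrow> _")
proof -
  have K: "is_functor D ?E ?K" by (rule comparison_functor[OF adj])
  have alg: "Fo ?K y \<in> EM_alg C (comp_ftr U F) \<eta> (\<lambda>x. Fa U (\<epsilon> (Fo F x)))" if "y \<in> Ob D" for y
    using is_functorD(3)[OF K that] by (simp add: adj_EM_cat_def EM_simps)
  have Ko: "Fo ?K y = (Fo U y, Fa U (\<epsilon> y))" for y by (simp add: comparison_ftr_def)
  have Ka: "Fa ?K n = k \<longleftrightarrow> Fa U n = fst (snd k)" if n: "n \<in> hom D y y'" and
      k: "k \<in> hom ?E (Fo ?K y) (Fo ?K y')" for n k y y'
    using n k by (cases k) (auto simp: hom_def comparison_ftr_def adj_EM_cat_def EM_simps)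
  have homE: "k \<in> hom ?E (Fo ?K y) (Fo ?K y') \<longleftrightarrow>
      (\<exists>m \<in> hom C (Fo U y) (Fo U y'). m \<cdot>\<^bsub>C\<^esub> Fa U (\<epsilon> y) = Fa U (\<epsilon> y') \<cdot>\<^bsub>C\<^esub> Fa U (Fa F m) \<and>
         k = (Fo ?K y, m, Fo ?K y'))" if "y \<in> Ob D" "y' \<in> Ob D" for k y y'
    using alg[OF that(1)] alg[OF that(2)]
    by (cases k) (auto simp: hom_def adj_EM_cat_def EM_simps EM_Ar Ko)
  have "(\<forall>k \<in> hom ?E (Fo ?K y) (Fo ?K y'). \<exists>!n. n \<in> hom D y y' \<and> Fa ?K n = k) \<longleftrightarrow>
     (\<forall>m \<in> hom C (Fo U y) (Fo U y').
        m \<cdot>\<^bsub>C\<^esub> Fa U (\<epsilon> y) = Fa U (\<epsilon> y') \<cdot>\<^bsub>C\<^esub> Fa U (Fa F m) \<longrightarrow>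
        (\<exists>!n. n \<in> hom D y y' \<and> Fa U n = m))" (is "?L \<longleftrightarrow> ?R") if y: "y \<in> Ob D" "y' \<in> Ob D" for y y'
  proof -
    have "?L \<longleftrightarrow> (\<forall>k \<in> hom ?E (Fo ?K y) (Fo ?K y'). \<exists>!n. n \<in> hom D y y' \<and> Fa U n = fst (snd k))"
      by (intro ball_cong refl) (simp add: Ka cong: conj_cong)
    moreover have "(\<forall>k \<in> hom ?E (Fo ?K y) (Fo ?K y'). P (fst (snd k))) \<longleftrightarrow>
        (\<forall>m \<in> hom C (Fo U y) (Fo U y').
          m \<cdot>\<^bsub>C\<^esub> Fa U (\<epsilon> y) = Fa U (\<epsilon> y') \<cdot>\<^bsub>C\<^esub> Fa U (Fa F m) \<longrightarrow> P m)" for P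
      unfolding Ball_def homE[OF y] by (auto simp: Ko)
    ultimately show ?thesis by simp
  qed
  then show ?thesis
    unfolding fully_faithful_def algebra_maps_lift_uniquely_def using K by simp
qed

lemma comparison_essentially_surjective_iff:
  assumes adj: "adjunction C D F U \<eta> \<epsilon>"
  shows "essentially_surjective D (adj_EM_cat C F U \<eta> \<epsilon>) (comparison_ftr D U \<epsilon>) \<longleftrightarrow>
    algebras_lift C D F U \<eta> \<epsilon>" (is "essentially_surjective D ?E ?K \<longleftrightarrow> _")
proof -
  have K: "is_functor D ?E ?K" by (rule comparison_functor[OF adj])
  let ?A = "EM_alg C (comp_ftr U F) \<eta> (\<lambda>x. Fa U (\<epsilon> (Fo F x)))"
  have T: "is_functor C C (comp_ftr U F)"
    using comp_functor adjunctionD(1,2)[OF adj] by blast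
  have "isomorphic ?E (Fo ?K y) (x, h) \<longleftrightarrow>
      (\<exists>\<phi> \<in> hom C (Fo U y) x. iso_arr C \<phi> \<and> \<phi> \<cdot>\<^bsub>C\<^esub> Fa U (\<epsilon> y) = h \<cdot>\<^bsub>C\<^esub> Fa U (Fa F \<phi>))"
    if y: "y \<in> Ob D" and xh: "(x, h) \<in> ?A" for x h y
  proof -
    have "(Fo U y, Fa U (\<epsilon> y)) \<in> ?A"
      using is_functorD(3)[OF K y] by (simp add: adj_EM_cat_def EM_simps comparison_ftr_def)
    then have "k \<in> hom ?E (Fo ?K y) (x, h) \<and> iso_arr ?E k \<longleftrightarrow> (\<exists>\<phi> \<in> hom C (Fo U y) x.
        iso_arr C \<phi> \<and> \<phi> \<cdot>\<^bsub>C\<^esub> Fa U (\<epsilon> y) = h \<cdot>\<^bsub>C\<^esub> Fa U (Fa F \<phi>) \<and> k = (Fo ?K y, \<phi>, (x, h)))" for k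
      using xh
      by (cases k)
        (auto simp: hom_def adj_EM_cat_def EM_simps EM_Ar comparison_ftr_def EM_iso_arr_iff[OF T])
    then show ?thesis unfolding isomorphic_def by blast
  qed
  then have "(\<exists>y \<in> Ob D. isomorphic ?E (Fo ?K y) (x, h)) \<longleftrightarrow> (\<exists>y \<in> Ob D. \<exists>\<phi> \<in> hom C (Fo U y) x.
      iso_arr C \<phi> \<and> \<phi> \<cdot>\<^bsub>C\<^esub> Fa U (\<epsilon> y) = h \<cdot>\<^bsub>C\<^esub> Fa U (Fa F \<phi>))" if "(x, h) \<in> ?A" for x h
    using that by (intro bex_cong refl)
  moreover have "Ob ?E = ?A" by (simp add: adj_EM_cat_def EM_simps)
  ultimately show ?thesis
    unfolding essentially_surjective_def algebras_lift_def
    by (intro ball_cong) clarsimp+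
qed

lemma monadic_adjunction_iff:
  "monadic_adjunction C D F U \<eta> \<epsilon> \<longleftrightarrow> adjunction C D F U \<eta> \<epsilon> \<and>
     algebra_maps_lift_uniquely C D F U \<epsilon> \<and> algebras_lift C D F U \<eta> \<epsilon>"
  unfolding monadic_adjunction_def
  using comparison_fully_faithful_iff comparison_essentially_surjective_iff equivalenceI
    equivalence_fully_faithful equivalence_essentially_surjective by metis

section \<open>Coreflective subcategories\<close>

text \<open>A coreflective subcategory whose inclusion \<open>L\<close> has the coreflector \<open>R\<close> as a retraction on the
  nose. The unit is then the identity, and the adjunction \<open>L -| R\<close> is encoded by its counit \<open>\<sigma>\<close>, with
  the two triangle identities as the last two assumptions.\<close>

locale coreflection =
  fixes B :: "('o, 'm) cat" and X :: "('p, 'n) cat"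
    and L :: "('o, 'm, 'p, 'n) ftr" and R :: "('p, 'n, 'o, 'm) ftr" and \<sigma> :: "'p \<Rightarrow> 'n"
  assumes L_functor: "is_functor B X L" and R_functor: "is_functor X B R"
    and counit: "nat_trans X X (comp_ftr L R) id_ftr \<sigma>"
    and R_L_Ob [simp]: "x \<in> Ob B \<Longrightarrow> Fo R (Fo L x) = x"
    and R_L_Ar [simp]: "f \<in> Ar B \<Longrightarrow> Fa R (Fa L f) = f"
    and R_counit [simp]: "y \<in> Ob X \<Longrightarrow> Fa R (\<sigma> y) = Ide B (Fo R y)"
    and counit_L [simp]: "x \<in> Ob B \<Longrightarrow> \<sigma> (Fo L x) = Ide X (Fo L x)"
begin

sublocale B: category B by (rule is_functorD[OF L_functor])
sublocale X: category X by (rule is_functorD[OF L_functor])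

lemmas L_simps [simp] = is_functorD(3-8)[OF L_functor]
lemmas R_simps [simp] = is_functorD(3-8)[OF R_functor]
lemmas counit_simps [simp] = nat_transD(3-5)[OF counit, simplified]

lemma counit_natural: "f \<in> Ar X \<Longrightarrow> \<sigma> (Cod X f) \<cdot>\<^bsub>X\<^esub> Fa L (Fa R f) = f \<cdot>\<^bsub>X\<^esub> \<sigma> (Dom X f)"
  using nat_transD(6)[OF counit] by simp

lemma counit_natural_from_L:
  assumes "f \<in> Ar X" "x \<in> Ob B" "Dom X f = Fo L x"
  shows "\<sigma> (Cod X f) \<cdot>\<^bsub>X\<^esub> Fa L (Fa R f) = f"
  using counit_natural[OF assms(1)] assms by simp

lemma counit_natural_into_L:
  assumes "f \<in> Ar X" "y \<in> Ob B" "Cod X f = Fo L y"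
  shows "f \<cdot>\<^bsub>X\<^esub> \<sigma> (Dom X f) = Fa L (Fa R f)"
  using counit_natural[OF assms(1)] assms by simp

text \<open>If \<open>\<sigma> x\<close> is invertible, then \<open>x\<close> is isomorphic to the object \<open>L (R x)\<close> of the subcategory, so by
  the adjunction arrows \<open>x \<rightarrow> y\<close> correspond to arrows \<open>R x \<rightarrow> R y\<close>. This lemma and \<open>R_full_at\<close> are the
  two halves of that correspondence.\<close>

lemma R_reflects_equality:
  assumes \<sigma>: "iso_arr X (\<sigma> x)" and x: "x \<in> Ob X"
    and f: "f \<in> Ar X" "Dom X f = x" and g: "g \<in> Ar X" "Dom X g = x" "Cod X g = Cod X f"
    and eq: "Fa R f = Fa R g"
  shows "f = g"
proof (rule X.iso_arr_cancel_right[OF \<sigma>])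
  show "f \<cdot>\<^bsub>X\<^esub> \<sigma> x = g \<cdot>\<^bsub>X\<^esub> \<sigma> x"
    using counit_natural[OF f(1)] counit_natural[OF g(1)] f g eq by simp
qed (use f g x in simp_all)

text \<open>The form in which equations between algebra structures are checked: these have a domain
  such as \<open>U F x\<close>, which is only known to be isomorphic to an object with invertible counit.\<close>

lemma R_reflects_equality_along:
  assumes e: "iso_arr X e" and \<sigma>: "iso_arr X (\<sigma> (Dom X e))"
    and f: "f \<in> Ar X" "Dom X f = Cod X e" and g: "g \<in> Ar X" "Dom X g = Cod X e" "Cod X g = Cod X f"
    and eq: "Fa R f \<cdot>\<^bsub>B\<^esub> Fa R e = Fa R g \<cdot>\<^bsub>B\<^esub> Fa R e"
  shows "f = g"
proof -
  note eA = iso_arr_in_Ar[OF e]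
  have "f \<cdot>\<^bsub>X\<^esub> e = g \<cdot>\<^bsub>X\<^esub> e"
    by (rule R_reflects_equality[OF \<sigma>]) (use eA f g eq in simp_all)
  then show ?thesis using X.iso_arr_cancel_right[OF e] f g by simp
qed

lemma R_full_at:
  assumes \<sigma>: "iso_arr X (\<sigma> x)" and x: "x \<in> Ob X" and y: "y \<in> Ob X"
    and m: "m \<in> Ar B" "Dom B m = Fo R x" "Cod B m = Fo R y"
  obtains f where "f \<in> Ar X" "Dom X f = x" "Cod X f = y" "Fa R f = m"
proof -
  obtain s where s: "s \<in> Ar X" "Dom X s = x" "Cod X s = Fo L (Fo R x)"
    "s \<cdot>\<^bsub>X\<^esub> \<sigma> x = Ide X (Fo L (Fo R x))" "\<sigma> x \<cdot>\<^bsub>X\<^esub> s = Ide X x"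
    using iso_arr_inverse[OF \<sigma>] x by (metis counit_simps(2,3))
  \<comment> \<open>Since \<open>R\<close> sends \<open>\<sigma> x\<close> to an identity, it sends its inverse to an identity as well.\<close>
  have "Fa R (s \<cdot>\<^bsub>X\<^esub> \<sigma> x) = Ide B (Fo R x)" using x by (simp add: s(4))
  then have Rs: "Fa R s = Ide B (Fo R x)" using s(1-3) x by simp
  show ?thesis
    by (rule that[of "\<sigma> y \<cdot>\<^bsub>X\<^esub> (Fa L m \<cdot>\<^bsub>X\<^esub> s)"]) (use s(1-3) x y m in \<open>simp_all add: Rs\<close>)
qed

end

section \<open>Restricting a monadic adjunction to coreflective subcategories\<close>

text \<open>An adjunction \<open>F -| U\<close> between \<open>C\<close> and \<open>D\<close>, and coreflective subcategories \<open>C'\<close> and \<open>D'\<close> such that \<open>F\<close>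
  restricts to \<open>F' : C' \<rightarrow> D'\<close> and commutes with the coreflections. The last assumption says that \<open>U\<close>
  sends \<open>D'\<close> into \<open>C'\<close> up to isomorphism. Only \<open>F\<close> commutes with the coreflections strictly, because
  \<open>U\<close> is an arbitrary right adjoint, determined up to isomorphism.\<close>

locale adjunction_over_coreflections =
  C: coreflection C' C I R \<sigma> + D: coreflection D' D J S \<tau>
  for C' :: "('o, 'm) cat" and C :: "('p, 'n) cat" and I R \<sigma>
    and D' :: "('q, 'k) cat" and D :: "('r, 'l) cat" and J S \<tau> +
  fixes F :: "('p, 'n, 'r, 'l) ftr" and U :: "('r, 'l, 'p, 'n) ftr" and \<eta> :: "'p \<Rightarrow> 'n"
    and \<epsilon> :: "'r \<Rightarrow> 'l" and F' :: "('o, 'm, 'q, 'k) ftr"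
  assumes adj: "adjunction C D F U \<eta> \<epsilon>" and F'_functor: "is_functor C' D' F'"
    and F_I_Ob [simp]: "a \<in> Ob C' \<Longrightarrow> Fo F (Fo I a) = Fo J (Fo F' a)"
    and F_I_Ar [simp]: "f \<in> Ar C' \<Longrightarrow> Fa F (Fa I f) = Fa J (Fa F' f)"
    and S_F_Ob [simp]: "x \<in> Ob C \<Longrightarrow> Fo S (Fo F x) = Fo F' (Fo R x)"
    and S_F_Ar [simp]: "g \<in> Ar C \<Longrightarrow> Fa S (Fa F g) = Fa F' (Fa R g)"
    and F_counit: "x \<in> Ob C \<Longrightarrow> Fa F (\<sigma> x) = \<tau> (Fo F x)"
    and U_J_coreflective: "b \<in> Ob D' \<Longrightarrow> iso_arr C (\<sigma> (Fo U (Fo J b)))"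
begin

lemmas F_simps [simp] = is_functorD(3-8)[OF adjunctionD(1)[OF adj]]
lemmas U_simps [simp] = is_functorD(3-8)[OF adjunctionD(2)[OF adj]]
lemmas F'_simps [simp] = is_functorD(3-8)[OF F'_functor]
lemmas unit_simps [simp] = nat_transD(3-5)[OF adjunctionD(3)[OF adj], simplified]
lemmas counit_simps [simp] = nat_transD(3-5)[OF adjunctionD(4)[OF adj], simplified]
lemmas unit_natural = nat_transD(6)[OF adjunctionD(3)[OF adj], simplified]
lemmas counit_natural = nat_transD(6)[OF adjunctionD(4)[OF adj], simplified]

text \<open>Maps \<open>F' a \<rightarrow> b\<close> are maps \<open>F (I a) = J (F' a) \<rightarrow> J b\<close>, thus maps \<open>I a \<rightarrow> U (J b)\<close>, thus maps
  \<open>a \<rightarrow> R (U (J b))\<close>; this determines the right adjoint of \<open>F'\<close> with its unit and counit.\<close>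

definition "U' = comp_ftr R (comp_ftr U J)"
definition "\<eta>' a = Fa R (\<eta> (Fo I a))"
definition "\<epsilon>' b = Fa S (\<epsilon> (Fo J b))"

lemma U'_Fo [simp]: "Fo U' b = Fo R (Fo U (Fo J b))"
  and U'_Fa [simp]: "Fa U' g = Fa R (Fa U (Fa J g))"
  by (simp_all add: U'_def)

lemma U'_functor: "is_functor D' C' U'"
  unfolding U'_def
  by (rule comp_functor[OF comp_functor[OF D.L_functor adjunctionD(2)[OF adj]] C.R_functor])

text \<open>Naturality of \<open>\<tau>\<close> at the counit of the adjunction. It compares the counit with its
  coreflection, and for \<open>y = J b\<close>, where \<open>\<tau> y\<close> is an identity, it expresses the counit \<open>\<epsilon>'\<close> of the
  restricted adjunction in terms of \<open>\<epsilon>\<close>.\<close>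

lemma counit_F_counit:
  assumes "y \<in> Ob D"
  shows "\<tau> y \<cdot>\<^bsub>D\<^esub> Fa J (Fa S (\<epsilon> y)) = \<epsilon> y \<cdot>\<^bsub>D\<^esub> Fa F (\<sigma> (Fo U y))"
  using D.counit_natural[of "\<epsilon> y"] assms by (simp add: F_counit)

lemma counit_F_counit_J:
  assumes "b \<in> Ob D'"
  shows "Fa J (\<epsilon>' b) = \<epsilon> (Fo J b) \<cdot>\<^bsub>D\<^esub> Fa F (\<sigma> (Fo U (Fo J b)))"
  using counit_F_counit[of "Fo J b"] assms by (simp add: \<epsilon>'_def)

lemma \<eta>'_simps [simp]:
  assumes "a \<in> Ob C'"
  shows "\<eta>' a \<in> Ar C'" "Dom C' (\<eta>' a) = a" "Cod C' (\<eta>' a) = Fo U' (Fo F' a)"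
  using assms by (simp_all add: \<eta>'_def)

lemma \<epsilon>'_simps [simp]:
  assumes "b \<in> Ob D'"
  shows "\<epsilon>' b \<in> Ar D'" "Dom D' (\<epsilon>' b) = Fo F' (Fo U' b)" "Cod D' (\<epsilon>' b) = b"
  using assms by (simp_all add: \<epsilon>'_def)

text \<open>Under \<open>F -| U\<close> the arrow \<open>\<sigma> (U y)\<close> is the transpose of \<open>\<epsilon> y\<close> after \<open>F (\<sigma> (U y))\<close>.\<close>

lemma transpose_F_counit:
  assumes y: "y \<in> Ob D"
  shows "Fa U (\<epsilon> y) \<cdot>\<^bsub>C\<^esub> (Fa U (Fa F (\<sigma> (Fo U y))) \<cdot>\<^bsub>C\<^esub> \<eta> (Fo I (Fo R (Fo U y)))) = \<sigma> (Fo U y)"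
proof -
  let ?x = "Fo U y"
  have "Fa U (\<epsilon> y) \<cdot>\<^bsub>C\<^esub> (Fa U (Fa F (\<sigma> ?x)) \<cdot>\<^bsub>C\<^esub> \<eta> (Fo I (Fo R ?x)))
          = Fa U (\<epsilon> y) \<cdot>\<^bsub>C\<^esub> (\<eta> ?x \<cdot>\<^bsub>C\<^esub> \<sigma> ?x)"
    using unit_natural[of "\<sigma> ?x"] y by simp
  also have "\<dots> = (Fa U (\<epsilon> y) \<cdot>\<^bsub>C\<^esub> \<eta> ?x) \<cdot>\<^bsub>C\<^esub> \<sigma> ?x"
    by (rule C.X.Cmp_assoc') (use y in simp_all)
  finally show ?thesis using y adjunctionD(6)[OF adj y] by simp
qed

lemma restricted_triangle:
  assumes b: "b \<in> Ob D'"
  shows "Fa U' (\<epsilon>' b) \<cdot>\<^bsub>C'\<^esub> \<eta>' (Fo U' b) = Ide C' (Fo U' b)"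
proof -
  let ?y = "Fo J b"
  have "Fa U (Fa J (\<epsilon>' b)) \<cdot>\<^bsub>C\<^esub> \<eta> (Fo I (Fo R (Fo U ?y))) = \<sigma> (Fo U ?y)"
    using transpose_F_counit[of ?y] b by (simp add: counit_F_counit_J C.X.Cmp_assoc'[symmetric])
  from arg_cong[OF this, of "Fa R"] show ?thesis
    using b by (simp add: \<eta>'_def)
qed

lemma restricted_adjunction: "adjunction C' D' F' U' \<eta>' \<epsilon>'"
  unfolding adjunction_def
proof (intro conjI ballI)
  show "nat_trans C' C' id_ftr (comp_ftr U' F') \<eta>'"
    unfolding nat_trans_def
  proof (intro conjI ballI)
    fix f assume f: "f \<in> Ar C'"
    show "\<eta>' (Cod C' f) \<cdot>\<^bsub>C'\<^esub> Fa id_ftr f = Fa (comp_ftr U' F') f \<cdot>\<^bsub>C'\<^esub> \<eta>' (Dom C' f)"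
      using arg_cong[OF unit_natural[of "Fa I f"], of "Fa R"] f by (simp add: \<eta>'_def)
  qed (use C.B.category_axioms comp_functor[OF F'_functor U'_functor] in
      \<open>auto simp: is_functor_def hom_def\<close>)
  show "nat_trans D' D' (comp_ftr F' U') id_ftr \<epsilon>'"
    unfolding nat_trans_def
  proof (intro conjI ballI)
    fix g assume g: "g \<in> Ar D'"
    show "\<epsilon>' (Cod D' g) \<cdot>\<^bsub>D'\<^esub> Fa (comp_ftr F' U') g = Fa id_ftr g \<cdot>\<^bsub>D'\<^esub> \<epsilon>' (Dom D' g)"
      using arg_cong[OF counit_natural[of "Fa J g"], of "Fa S"] g by (simp add: \<epsilon>'_def)
  qed (use D.B.category_axioms comp_functor[OF U'_functor F'_functor] in
      \<open>auto simp: is_functor_def hom_def\<close>)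
  fix a assume a: "a \<in> Ob C'"
  show "\<epsilon>' (Fo F' a) \<cdot>\<^bsub>D'\<^esub> Fa F' (\<eta>' a) = Ide D' (Fo F' a)"
    using arg_cong[OF adjunctionD(5)[OF adj, of "Fo I a"], of "Fa S"] a
    by (simp add: \<epsilon>'_def \<eta>'_def)
qed (use F'_functor U'_functor restricted_triangle in simp_all)

text \<open>By uniqueness of right adjoints, the equality \<open>F I = J F'\<close> makes \<open>R U\<close> isomorphic to \<open>U' S\<close>. The
  isomorphism is the image under \<open>R U\<close> of the counit \<open>\<tau>\<close>, and its inverse \<open>?w\<close> below is the transpose
  of \<open>S (\<epsilon> y)\<close> under \<open>F' -| U'\<close>.\<close>

lemma R_U_counit_iso:
  assumes y: "y \<in> Ob D"
  shows "iso_arr C' (Fa R (Fa U (\<tau> y)))"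
proof -
  let ?t = "Fa U (\<tau> y)" and ?k = "Fa J (Fa S (\<epsilon> y))" and ?a = "Fo R (Fo U y)"
  let ?a' = "Fo R (Fo U (Fo J (Fo S y)))"
  let ?w = "Fa R (Fa U ?k) \<cdot>\<^bsub>C'\<^esub> \<eta>' ?a"
  have "?t \<cdot>\<^bsub>C\<^esub> (Fa U ?k \<cdot>\<^bsub>C\<^esub> \<eta> (Fo I ?a)) = \<sigma> (Fo U y)"
    using transpose_F_counit[OF y] arg_cong[OF counit_F_counit[OF y], of "Fa U"] y
    by (simp add: C.X.Cmp_assoc')
  from arg_cong[OF this, of "Fa R"]
  have 1: "Fa R ?t \<cdot>\<^bsub>C'\<^esub> ?w = Ide C' ?a"
    using y by (simp add: \<eta>'_def)
  have "?k \<cdot>\<^bsub>D\<^esub> Fa F (Fa I (Fa R ?t)) = Fa J (Fa S (\<epsilon> y \<cdot>\<^bsub>D\<^esub> Fa F ?t))"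
    using y by simp
  also have "\<dots> = Fa J (\<epsilon>' (Fo S y))"
    using counit_natural[of "\<tau> y"] y by (simp add: \<epsilon>'_def)
  finally have k: "?k \<cdot>\<^bsub>D\<^esub> Fa F (Fa I (Fa R ?t)) = Fa J (\<epsilon>' (Fo S y))" .
  have "?w \<cdot>\<^bsub>C'\<^esub> Fa R ?t = Fa R (Fa U ?k) \<cdot>\<^bsub>C'\<^esub> (\<eta>' ?a \<cdot>\<^bsub>C'\<^esub> Fa R ?t)"
    using y by (simp add: C.B.Cmp_assoc')
  also have "\<eta>' ?a \<cdot>\<^bsub>C'\<^esub> Fa R ?t = Fa R (Fa U (Fa F (Fa I (Fa R ?t)))) \<cdot>\<^bsub>C'\<^esub> \<eta>' ?a'"
    using nat_transD(6)[OF adjunctionD(3)[OF restricted_adjunction], of "Fa R ?t"] y by simp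
  also have "Fa R (Fa U ?k) \<cdot>\<^bsub>C'\<^esub> \<dots> = Fa R (Fa U (?k \<cdot>\<^bsub>D\<^esub> Fa F (Fa I (Fa R ?t)))) \<cdot>\<^bsub>C'\<^esub> \<eta>' ?a'"
    using y by (simp add: C.B.Cmp_assoc')
  also have "\<dots> = Ide C' ?a'"
    unfolding k using restricted_triangle[of "Fo S y"] y by simp
  finally have 2: "?w \<cdot>\<^bsub>C'\<^esub> Fa R ?t = Ide C' ?a'" .
  show ?thesis
    by (rule iso_arrI[of _ _ ?w]) (use 1 2 y in simp_all)
qed

text \<open>An algebra map \<open>m : U' b \<rightarrow> U' b'\<close> lifts along \<open>R\<close> to \<open>k : U (J b) \<rightarrow> U (J b')\<close>, since \<open>\<sigma>\<close> is
  invertible at \<open>U (J b)\<close>. Monadicity of \<open>U\<close> gives \<open>n : J b \<rightarrow> J b'\<close> over \<open>k\<close>, and \<open>S n\<close> is the lift of \<open>m\<close>.\<close>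

lemma restricted_algebra_maps_lift_uniquely:
  assumes M: "algebra_maps_lift_uniquely C D F U \<epsilon>"
  shows "algebra_maps_lift_uniquely C' D' F' U' \<epsilon>'"
  unfolding algebra_maps_lift_uniquely_def
proof (intro ballI impI)
  fix b b' m
  assume b: "b \<in> Ob D'" "b' \<in> Ob D'" and "m \<in> hom C' (Fo U' b) (Fo U' b')"
    and alg: "m \<cdot>\<^bsub>C'\<^esub> Fa U' (\<epsilon>' b) = Fa U' (\<epsilon>' b') \<cdot>\<^bsub>C'\<^esub> Fa U' (Fa F' m)"
  let ?x = "Fo U (Fo J b)" and ?x' = "Fo U (Fo J b')"
  have m: "m \<in> Ar C'" "Dom C' m = Fo R ?x" "Cod C' m = Fo R ?x'"
    using \<open>m \<in> hom _ _ _\<close> by (auto simp: hom_def)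
  obtain k where k: "k \<in> Ar C" "Dom C k = ?x" "Cod C k = ?x'" "Fa R k = m"
    using C.R_full_at[OF U_J_coreflective[OF b(1)] _ _ m] b by (metis U_simps(1) D.L_simps(1))
  \<comment> \<open>The isomorphism \<open>?e\<close> shows that the domain \<open>U F U J b\<close> of the equation for \<open>k\<close> is
    isomorphic to an object at which \<open>\<sigma>\<close> is invertible: the source of \<open>?e\<close> is \<open>U F I R U J b = U J (F' R U J b)\<close>.\<close>
  let ?e = "Fa U (Fa F (\<sigma> ?x))"
  have e: "iso_arr C ?e" "?e \<in> Ar C" "Cod C ?e = Fo U (Fo F ?x)" "iso_arr C (\<sigma> (Dom C ?e))"
    using U_J_coreflective[OF b(1)] b
      U_J_coreflective[of "Fo F' (Fo R ?x)"]
    by (auto intro!: functor_iso_arr[OF adjunctionD(2)[OF adj]] functor_iso_arr[OF adjunctionD(1)[OF adj]])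
  have "k \<cdot>\<^bsub>C\<^esub> (Fa U (\<epsilon> (Fo J b)) \<cdot>\<^bsub>C\<^esub> ?e) = k \<cdot>\<^bsub>C\<^esub> Fa U (Fa J (\<epsilon>' b))"
    using b by (simp add: counit_F_counit_J)
  from arg_cong[OF this, of "Fa R"]
  have 1: "Fa R (k \<cdot>\<^bsub>C\<^esub> Fa U (\<epsilon> (Fo J b))) \<cdot>\<^bsub>C'\<^esub> Fa R ?e = m \<cdot>\<^bsub>C'\<^esub> Fa U' (\<epsilon>' b)"
    using b k m by (simp add: C.B.Cmp_assoc')
  have "k \<cdot>\<^bsub>C\<^esub> \<sigma> ?x = \<sigma> ?x' \<cdot>\<^bsub>C\<^esub> Fa I m"
    using C.counit_natural[OF k(1)] k by simp
  then have "Fa U (\<epsilon> (Fo J b') \<cdot>\<^bsub>D\<^esub> Fa F (k \<cdot>\<^bsub>C\<^esub> \<sigma> ?x)) =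
      Fa U ((\<epsilon> (Fo J b') \<cdot>\<^bsub>D\<^esub> Fa F (\<sigma> ?x')) \<cdot>\<^bsub>D\<^esub> Fa F (Fa I m))"
    using b m by (simp add: D.X.Cmp_assoc' del: F_I_Ar)
  also have "\<dots> = Fa U (Fa J (\<epsilon>' b') \<cdot>\<^bsub>D\<^esub> Fa J (Fa F' m))"
    using b m by (simp add: counit_F_counit_J)
  finally have "Fa U (\<epsilon> (Fo J b') \<cdot>\<^bsub>D\<^esub> Fa F (k \<cdot>\<^bsub>C\<^esub> \<sigma> ?x)) =
      Fa U (Fa J (\<epsilon>' b') \<cdot>\<^bsub>D\<^esub> Fa J (Fa F' m))" .
  from arg_cong[OF this, of "Fa R"]
  have 2: "Fa R (Fa U (\<epsilon> (Fo J b')) \<cdot>\<^bsub>C\<^esub> Fa U (Fa F k)) \<cdot>\<^bsub>C'\<^esub> Fa R ?e =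
      Fa U' (\<epsilon>' b') \<cdot>\<^bsub>C'\<^esub> Fa U' (Fa F' m)"
    using b k m by (simp add: C.B.Cmp_assoc')
  have kalg: "k \<cdot>\<^bsub>C\<^esub> Fa U (\<epsilon> (Fo J b)) = Fa U (\<epsilon> (Fo J b')) \<cdot>\<^bsub>C\<^esub> Fa U (Fa F k)"
    by (rule C.R_reflects_equality_along[OF e(1,4)]) (use b k e(3) alg 1 2 in simp_all)
  have lift: "\<exists>!n. n \<in> hom D (Fo J b) (Fo J b') \<and> Fa U n = k"
    using M b k kalg unfolding algebra_maps_lift_uniquely_def by (simp add: hom_def)
  then obtain n where n: "n \<in> Ar D" "Dom D n = Fo J b" "Cod D n = Fo J b'" "Fa U n = k"
    by (auto simp: hom_def)
  have JSn: "Fa J (Fa S n) = n"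
    using D.counit_natural_from_L[OF n(1) b(1) n(2)] n b by simp
  show "\<exists>!n. n \<in> hom D' b b' \<and> Fa U' n = m"
  proof (rule ex1I[of _ "Fa S n"])
    show "Fa S n \<in> hom D' b b' \<and> Fa U' (Fa S n) = m"
      using n b k by (simp add: hom_def JSn)
  next
    fix l assume "l \<in> hom D' b b' \<and> Fa U' l = m"
    then have l: "l \<in> Ar D'" "Dom D' l = b" "Cod D' l = b'" "Fa R (Fa U (Fa J l)) = m"
      by (auto simp: hom_def)
    have "Fa U (Fa J l) = k"
      by (rule C.R_reflects_equality[OF U_J_coreflective[OF b(1)]]) (use b k l in simp_all)
    then have "Fa J l = n"
      using lift n l by (auto simp: hom_def)
    then show "l = Fa S n" using l D.R_L_Ar by metis
  qed
qed

text \<open>An algebra \<open>h : U' F' a \<rightarrow> a\<close> lifts along \<open>R\<close> to \<open>k : U F (I a) \<rightarrow> I a\<close>, and both algebra laws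
  for \<open>k\<close> may be checked after applying \<open>R\<close>. Monadicity of \<open>U\<close> gives \<open>y\<close> with an isomorphism of algebras
  \<open>\<phi> : U y \<rightarrow> I a\<close>. The object \<open>y\<close> need not lie in the subcategory, so it is replaced by \<open>S y\<close>; by
  \<open>R_U_counit_iso\<close> this does not change the underlying object.\<close>

lemma restricted_algebras_lift:
  assumes E: "algebras_lift C D F U \<eta> \<epsilon>"
  shows "algebras_lift C' D' F' U' \<eta>' \<epsilon>'"
  unfolding algebras_lift_def
proof clarify
  fix a h
  assume "(a, h) \<in> EM_alg C' (comp_ftr U' F') \<eta>' (\<lambda>x. Fa U' (\<epsilon>' (Fo F' x)))"
  then have a: "a \<in> Ob C'" and h: "h \<in> Ar C'" "Dom C' h = Fo R (Fo U (Fo J (Fo F' a)))" "Cod C' h = a"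
    and h_unit: "h \<cdot>\<^bsub>C'\<^esub> \<eta>' a = Ide C' a"
    and h_mult: "h \<cdot>\<^bsub>C'\<^esub> Fa U' (\<epsilon>' (Fo F' a)) = h \<cdot>\<^bsub>C'\<^esub> Fa U' (Fa F' h)"
    by (auto simp: EM_alg_def hom_def)
  let ?b = "Fo F' a"
  let ?x = "Fo U (Fo J ?b)"
  have b: "?b \<in> Ob D'" using a by simp
  have "Cod C' h = Fo R (Fo I a)" using a h by simp
  then obtain k where k: "k \<in> Ar C" "Dom C k = ?x" "Cod C k = Fo I a" "Fa R k = h"
    using C.R_full_at[OF U_J_coreflective[OF b] _ _ h(1,2)] a b by (metis U_simps(1) D.L_simps(1) C.L_simps(1))
  have k\<sigma>: "k \<cdot>\<^bsub>C\<^esub> \<sigma> ?x = Fa I h"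
    using C.counit_natural_into_L[OF k(1) a k(3)] k by simp
  have "iso_arr C (\<sigma> (Fo I a))"
    using a by (intro iso_arrI[of _ _ "Ide C (Fo I a)"]) simp_all
  then have k_unit: "k \<cdot>\<^bsub>C\<^esub> \<eta> (Fo I a) = Ide C (Fo I a)"
    by (rule C.R_reflects_equality) (use a k h_unit in \<open>simp_all add: \<eta>'_def\<close>)
  let ?e = "Fa U (Fa F (\<sigma> ?x))"
  have e: "iso_arr C ?e" "Cod C ?e = Fo U (Fo F ?x)" "iso_arr C (\<sigma> (Dom C ?e))"
    using U_J_coreflective[OF b] b U_J_coreflective[of "Fo F' (Fo R ?x)"]
    by (auto intro!: functor_iso_arr[OF adjunctionD(2)[OF adj]] functor_iso_arr[OF adjunctionD(1)[OF adj]])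
  have k_mult: "k \<cdot>\<^bsub>C\<^esub> Fa U (\<epsilon> (Fo J ?b)) = k \<cdot>\<^bsub>C\<^esub> Fa U (Fa F k)"
  proof (rule C.R_reflects_equality_along[OF e(1,3)])
    have "k \<cdot>\<^bsub>C\<^esub> (Fa U (\<epsilon> (Fo J ?b)) \<cdot>\<^bsub>C\<^esub> ?e) = k \<cdot>\<^bsub>C\<^esub> Fa U (Fa J (\<epsilon>' ?b))"
      using b by (simp add: counit_F_counit_J)
    from arg_cong[OF this, of "Fa R"]
    have 1: "Fa R (k \<cdot>\<^bsub>C\<^esub> Fa U (\<epsilon> (Fo J ?b))) \<cdot>\<^bsub>C'\<^esub> Fa R ?e = h \<cdot>\<^bsub>C'\<^esub> Fa U' (\<epsilon>' ?b)"
      using a b k h by (simp add: C.B.Cmp_assoc')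
    have "k \<cdot>\<^bsub>C\<^esub> Fa U (Fa F (k \<cdot>\<^bsub>C\<^esub> \<sigma> ?x)) = k \<cdot>\<^bsub>C\<^esub> Fa U (Fa J (Fa F' h))"
      using h by (simp add: k\<sigma>)
    from arg_cong[OF this, of "Fa R"]
    have "Fa R (k \<cdot>\<^bsub>C\<^esub> Fa U (Fa F k)) \<cdot>\<^bsub>C'\<^esub> Fa R ?e = h \<cdot>\<^bsub>C'\<^esub> Fa U' (Fa F' h)"
      using a b h k by (simp add: C.B.Cmp_assoc')
    then show "Fa R (k \<cdot>\<^bsub>C\<^esub> Fa U (\<epsilon> (Fo J ?b))) \<cdot>\<^bsub>C'\<^esub> Fa R ?e =
        Fa R (k \<cdot>\<^bsub>C\<^esub> Fa U (Fa F k)) \<cdot>\<^bsub>C'\<^esub> Fa R ?e"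
      using 1 h_mult by simp
  qed (use a b k e(2) in simp_all)
  have "(Fo I a, k) \<in> EM_alg C (comp_ftr U F) \<eta> (\<lambda>x. Fa U (\<epsilon> (Fo F x)))"
    using a k k_unit k_mult by (simp add: EM_alg_def hom_def)
  then obtain y \<phi> where y: "y \<in> Ob D" and \<phi>: "\<phi> \<in> Ar C" "Dom C \<phi> = Fo U y" "Cod C \<phi> = Fo I a"
    and \<phi>_iso: "iso_arr C \<phi>" and \<phi>_alg: "\<phi> \<cdot>\<^bsub>C\<^esub> Fa U (\<epsilon> y) = k \<cdot>\<^bsub>C\<^esub> Fa U (Fa F \<phi>)"
    using E unfolding algebras_lift_def hom_def by fastforce
  define b' where "b' = Fo S y"
  let ?x' = "Fo U (Fo J b')"
  let ?t = "Fa U (\<tau> y)"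
  define \<psi> where "\<psi> = Fa R \<phi> \<cdot>\<^bsub>C'\<^esub> Fa R ?t"
  have b': "b' \<in> Ob D'" using y by (simp add: b'_def)
  have \<psi>: "\<psi> \<in> Ar C'" "Dom C' \<psi> = Fo U' b'" "Cod C' \<psi> = a"
    using \<phi> y a by (simp_all add: \<psi>_def b'_def)
  have \<psi>_iso: "iso_arr C' \<psi>"
    unfolding \<psi>_def using \<phi> y
    by (intro C.B.iso_arr_Cmp R_U_counit_iso functor_iso_arr[OF C.R_functor \<phi>_iso]) simp_all
  have \<phi>t: "(\<phi> \<cdot>\<^bsub>C\<^esub> ?t) \<cdot>\<^bsub>C\<^esub> \<sigma> ?x' = Fa I \<psi>"
    using C.counit_natural_into_L[of "\<phi> \<cdot>\<^bsub>C\<^esub> ?t" a] \<phi> y a by (simp add: \<psi>_def b'_def)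
  \<comment> \<open>The image of \<open>\<tau> y\<close> under \<open>R U\<close> is a map of algebras, by naturality of \<open>\<epsilon>\<close> at \<open>\<tau> y\<close>. With
    \<open>\<phi>_alg\<close> it follows that \<open>\<psi>\<close> is a map of algebras.\<close>
  have "\<tau> y \<cdot>\<^bsub>D\<^esub> Fa J (\<epsilon>' b') = (\<tau> y \<cdot>\<^bsub>D\<^esub> \<epsilon> (Fo J b')) \<cdot>\<^bsub>D\<^esub> Fa F (\<sigma> ?x')"
    using y b' by (simp add: counit_F_counit_J) (simp add: D.X.Cmp_assoc' b'_def)
  also have "\<dots> = (\<epsilon> y \<cdot>\<^bsub>D\<^esub> Fa F ?t) \<cdot>\<^bsub>D\<^esub> Fa F (\<sigma> ?x')"
    using counit_natural[of "\<tau> y"] y by (simp add: b'_def)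
  finally have "\<tau> y \<cdot>\<^bsub>D\<^esub> Fa J (\<epsilon>' b') = (\<epsilon> y \<cdot>\<^bsub>D\<^esub> Fa F ?t) \<cdot>\<^bsub>D\<^esub> Fa F (\<sigma> ?x')" .
  from arg_cong[OF this, of "Fa U"]
  have "?t \<cdot>\<^bsub>C\<^esub> Fa U (Fa J (\<epsilon>' b')) = Fa U (\<epsilon> y) \<cdot>\<^bsub>C\<^esub> (Fa U (Fa F ?t) \<cdot>\<^bsub>C\<^esub> Fa U (Fa F (\<sigma> ?x')))"
    using y b' by (simp add: b'_def C.X.Cmp_assoc'[symmetric])
  then have "\<phi> \<cdot>\<^bsub>C\<^esub> (?t \<cdot>\<^bsub>C\<^esub> Fa U (Fa J (\<epsilon>' b'))) =
      (\<phi> \<cdot>\<^bsub>C\<^esub> Fa U (\<epsilon> y)) \<cdot>\<^bsub>C\<^esub> (Fa U (Fa F ?t) \<cdot>\<^bsub>C\<^esub> Fa U (Fa F (\<sigma> ?x')))"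
    using y b' \<phi> by (simp add: b'_def C.X.Cmp_assoc')
  also have "\<dots> = k \<cdot>\<^bsub>C\<^esub> Fa U (Fa F ((\<phi> \<cdot>\<^bsub>C\<^esub> ?t) \<cdot>\<^bsub>C\<^esub> \<sigma> ?x'))"
    unfolding \<phi>_alg using a y b' \<phi> k by (simp add: b'_def C.X.Cmp_assoc'[symmetric])
  also have "\<dots> = k \<cdot>\<^bsub>C\<^esub> Fa U (Fa J (Fa F' \<psi>))"
    unfolding \<phi>t using \<psi> by simp
  finally have "\<phi> \<cdot>\<^bsub>C\<^esub> (?t \<cdot>\<^bsub>C\<^esub> Fa U (Fa J (\<epsilon>' b'))) = k \<cdot>\<^bsub>C\<^esub> Fa U (Fa J (Fa F' \<psi>))" .
  from arg_cong[OF this, of "Fa R"]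
  have "\<psi> \<cdot>\<^bsub>C'\<^esub> Fa U' (\<epsilon>' b') = h \<cdot>\<^bsub>C'\<^esub> Fa U' (Fa F' \<psi>)"
    using a y b' \<phi> k \<psi> unfolding \<psi>_def by (simp add: b'_def C.B.Cmp_assoc')
  then show "\<exists>b \<in> Ob D'. \<exists>\<psi> \<in> hom C' (Fo U' b) a. iso_arr C' \<psi> \<and>
      \<psi> \<cdot>\<^bsub>C'\<^esub> Fa U' (\<epsilon>' b) = h \<cdot>\<^bsub>C'\<^esub> Fa U' (Fa F' \<psi>)"
    using b' \<psi> \<psi>_iso by (auto simp: hom_def)
qed

theorem monadic_restricts:
  assumes "monadic_adjunction C D F U \<eta> \<epsilon>"
  shows "monadic_adjunction C' D' F' U' \<eta>' \<epsilon>'"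
  using assms restricted_adjunction restricted_algebra_maps_lift_uniquely restricted_algebras_lift
  by (simp add: monadic_adjunction_iff)

end

section \<open>Functors and coreflections between slice categories\<close>

definition slice_ftr ::
    "('o, 'm) cat \<Rightarrow> ('o, 'm, 'p, 'n) ftr \<Rightarrow> ('m, 'm \<times> 'm \<times> 'm, 'n, 'n \<times> 'n \<times> 'n) ftr" where
  "slice_ftr C G = \<lparr>Fo = Fa G, Fa = (\<lambda>(f, h, g). (Fa G f, Fa G h, Fa G g))\<rparr>"

lemma slice_ftr_simps [simp]:
  "Fo (slice_ftr C G) f = Fa G f"
  "Fa (slice_ftr C G) (f, h, g) = (Fa G f, Fa G h, Fa G g)"
  by (simp_all add: slice_ftr_def)

lemma postcomp_ftr_simps [simp]:
  "Fo (postcomp_ftr C p) f = p \<cdot>\<^bsub>C\<^esub> f"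
  "Fa (postcomp_ftr C p) (f, h, g) = (p \<cdot>\<^bsub>C\<^esub> f, h, p \<cdot>\<^bsub>C\<^esub> g)"
  by (simp_all add: postcomp_ftr_def)

lemma slice_functor:
  assumes G: "is_functor C D G"
  shows "is_functor (slice_cat C a) (slice_cat D (Fo G a)) (slice_ftr C G)"
proof -
  note G' = is_functorD[OF G]
  interpret C: category C by (rule G')
  interpret D: category D by (rule G')
  show ?thesis
    using C.slice_category D.slice_category
    by (auto simp: is_functor_def hom_def C.slice_simps C.slice_Ar D.slice_simps D.slice_Ar G'
        simp flip: G'(8))
qed

context category
begin

text \<open>The forgetful functor of a slice category reflects isomorphisms.\<close>

lemma slice_iso_arr:
  assumes h: "(f, h, g) \<in> Ar (slice_cat C a)" and iso: "iso_arr C h"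
  shows "iso_arr (slice_cat C a) (f, h, g)"
proof -
  obtain k where k: "k \<in> Ar C" "Dom C k = Cod C h" "Cod C k = Dom C h"
    "k \<cdot> h = Ide C (Dom C h)" "h \<cdot> k = Ide C (Cod C h)"
    by (rule iso_arr_inverse[OF iso])
  have "f \<cdot> k = g \<cdot> (h \<cdot> k)"
    using h k(1-3) by (auto simp: slice_Ar Cmp_assoc')
  then have "f \<cdot> k = g" using h k by (simp add: slice_Ar)
  then show ?thesis
    by (intro iso_arrI[of _ _ "(g, k, f)"]) (use h k in \<open>simp_all add: slice_Ar slice_simps\<close>)
qed

end

context coreflection
begin

text \<open>The embedding of slices: \<open>L\<close> followed by composition with the counit at \<open>x\<close>, that is, the passage
  from \<open>w : c \<rightarrow> R x\<close> to its transpose \<open>L c \<rightarrow> x\<close>.\<close>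

definition slice_L :: "'p \<Rightarrow> ('m, 'm \<times> 'm \<times> 'm, 'n, 'n \<times> 'n \<times> 'n) ftr" where
  "slice_L x = comp_ftr (postcomp_ftr X (\<sigma> x)) (slice_ftr B L)"

definition slice_counit :: "'n \<Rightarrow> 'n \<times> 'n \<times> 'n" where
  "slice_counit t = (\<sigma> (Cod X t) \<cdot>\<^bsub>X\<^esub> Fa L (Fa R t), \<sigma> (Dom X t), t)"

lemma slice_coreflection:
  assumes x: "x \<in> Ob X"
  shows "coreflection (slice_cat B (Fo R x)) (slice_cat X x) (slice_L x) (slice_ftr X R) slice_counit"
proof
  note simps = B.slice_simps B.slice_Ar X.slice_simps X.slice_Ar hom_def
  show L: "is_functor (slice_cat B (Fo R x)) (slice_cat X x) (slice_L x)"
    unfolding slice_L_def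
    using comp_functor[OF slice_functor[OF L_functor, of "Fo R x"], of "slice_cat X x" "postcomp_ftr X (\<sigma> x)"]
      X.postcomp_functor[of "\<sigma> x"] x by simp
  show R: "is_functor (slice_cat X x) (slice_cat B (Fo R x)) (slice_ftr X R)"
    by (rule slice_functor[OF R_functor])
  show "nat_trans (slice_cat X x) (slice_cat X x) (comp_ftr (slice_L x) (slice_ftr X R)) id_ftr
      slice_counit"
    unfolding nat_trans_def
  proof (intro conjI ballI comp_functor[OF R L])
    show "is_functor (slice_cat X x) (slice_cat X x) id_ftr"
      using X.slice_category by (auto simp: is_functor_def simps)
    fix t assume "t \<in> Ob (slice_cat X x)"
    then show "slice_counit t \<in> hom (slice_cat X x) (Fo (comp_ftr (slice_L x) (slice_ftr X R)) t)
        (Fo id_ftr t)"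
      by (auto simp: simps slice_counit_def slice_L_def counit_natural)
  next
    fix k assume k: "k \<in> Ar (slice_cat X x)"
    then show "Cmp (slice_cat X x) (slice_counit (Cod (slice_cat X x) k))
        (Fa (comp_ftr (slice_L x) (slice_ftr X R)) k) =
      Cmp (slice_cat X x) (Fa id_ftr k) (slice_counit (Dom (slice_cat X x) k))"
      using counit_natural[of "fst (snd k)"]
      by (cases k) (auto simp: simps slice_counit_def slice_L_def)
  qed
next
  note simps = B.slice_simps B.slice_Ar X.slice_simps X.slice_Ar hom_def
  fix w assume w: "w \<in> Ob (slice_cat B (Fo R x))"
  then show "Fo (slice_ftr X R) (Fo (slice_L x) w) = w"
    using x by (simp add: simps slice_L_def)
  show "slice_counit (Fo (slice_L x) w) = Ide (slice_cat X x) (Fo (slice_L x) w)"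
    using w x by (simp add: simps slice_L_def slice_counit_def)
next
  note simps = B.slice_simps B.slice_Ar X.slice_simps X.slice_Ar hom_def
  fix k assume "k \<in> Ar (slice_cat B (Fo R x))"
  then show "Fa (slice_ftr X R) (Fa (slice_L x) k) = k"
    using x by (cases k) (auto simp: simps slice_L_def)
next
  note simps = B.slice_simps B.slice_Ar X.slice_simps X.slice_Ar hom_def
  fix t assume "t \<in> Ob (slice_cat X x)"
  then show "Fa (slice_ftr X R) (slice_counit t) = Ide (slice_cat B (Fo R x)) (Fo (slice_ftr X R) t)"
    by (auto simp: simps slice_counit_def)
qed

section \<open>Coreflections onto a sieve preserve effective descent\<close>

text \<open>The pullback of \<open>p\<close> along the transpose \<open>?q\<close> of \<open>w\<close> is preserved by the right adjoint \<open>R\<close>, and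
  \<open>R\<close> sends \<open>?q\<close> to \<open>w\<close>.\<close>

lemma R_has_pullbacks_along:
  assumes p: "p \<in> Ar X" and pb: "has_pullbacks_along X p"
  shows "has_pullbacks_along B (Fa R p)"
  unfolding has_pullbacks_along_def
proof (intro ballI impI)
  fix w assume w: "w \<in> Ar B" "Cod B w = Cod B (Fa R p)"
  let ?f = "Dom X p" and ?g = "Cod X p"
  let ?q = "\<sigma> ?g \<cdot>\<^bsub>X\<^esub> Fa L w"
  have q: "?q \<in> Ar X" "Dom X ?q = Fo L (Dom B w)" "Cod X ?q = ?g" "Fa R ?q = w"
    using p w by simp_all
  obtain r t where "is_pullback X p ?q r t"
    using pb q p unfolding has_pullbacks_along_def by metis
  then have rt: "r \<in> Ar X" "t \<in> Ar X" "Dom X t = Dom X r" "Cod X r = ?f"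
      "Cod X t = Fo L (Dom B w)" "p \<cdot>\<^bsub>X\<^esub> r = ?q \<cdot>\<^bsub>X\<^esub> t"
    and univ: "\<And>x u v. \<lbrakk>x \<in> Ob X; u \<in> hom X x ?f; v \<in> hom X x (Fo L (Dom B w));
        p \<cdot>\<^bsub>X\<^esub> u = ?q \<cdot>\<^bsub>X\<^esub> v\<rbrakk>
      \<Longrightarrow> \<exists>!h. h \<in> hom X x (Dom X r) \<and> r \<cdot>\<^bsub>X\<^esub> h = u \<and> t \<cdot>\<^bsub>X\<^esub> h = v"
    using q(2) unfolding is_pullback_def by metis+
  have "is_pullback B (Fa R p) w (Fa R r) (Fa R t)"
    unfolding is_pullback_def
  proof (intro conjI ballI impI)
    show "Fa R p \<cdot>\<^bsub>B\<^esub> Fa R r = w \<cdot>\<^bsub>B\<^esub> Fa R t"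
      using arg_cong[OF rt(6), of "Fa R"] rt(1-5) p w by simp
  next
    fix x u v
    assume x: "x \<in> Ob B" and "u \<in> hom B x (Dom B (Fa R p))" "v \<in> hom B x (Dom B w)"
      and eq: "Fa R p \<cdot>\<^bsub>B\<^esub> u = w \<cdot>\<^bsub>B\<^esub> v"
    then have u: "u \<in> Ar B" "Dom B u = x" "Cod B u = Fo R ?f"
      and v: "v \<in> Ar B" "Dom B v = x" "Cod B v = Dom B w"
      using p by (auto simp: hom_def)
    let ?u = "\<sigma> ?f \<cdot>\<^bsub>X\<^esub> Fa L u"
    have "p \<cdot>\<^bsub>X\<^esub> ?u = (\<sigma> ?g \<cdot>\<^bsub>X\<^esub> Fa L (Fa R p)) \<cdot>\<^bsub>X\<^esub> Fa L u"
      using p u by (simp add: counit_natural X.Cmp_assoc')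
    also have "\<dots> = \<sigma> ?g \<cdot>\<^bsub>X\<^esub> Fa L (Fa R p \<cdot>\<^bsub>B\<^esub> u)"
      using p u by (simp add: X.Cmp_assoc')
    also have "\<dots> = ?q \<cdot>\<^bsub>X\<^esub> Fa L v"
      unfolding eq using p w v by (simp add: X.Cmp_assoc')
    finally have ex1: "\<exists>!h. h \<in> hom X (Fo L x) (Dom X r) \<and> r \<cdot>\<^bsub>X\<^esub> h = ?u \<and> t \<cdot>\<^bsub>X\<^esub> h = Fa L v"
      by (intro univ) (use x p u v in \<open>simp_all add: hom_def\<close>)
    then obtain h where h: "h \<in> Ar X" "Dom X h = Fo L x" "Cod X h = Dom X r"
        "r \<cdot>\<^bsub>X\<^esub> h = ?u" "t \<cdot>\<^bsub>X\<^esub> h = Fa L v"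
      by (auto simp: hom_def)
    show "\<exists>!k. k \<in> hom B x (Dom B (Fa R r)) \<and> Fa R r \<cdot>\<^bsub>B\<^esub> k = u \<and> Fa R t \<cdot>\<^bsub>B\<^esub> k = v"
    proof (rule ex1I[of _ "Fa R h"])
      show "Fa R h \<in> hom B x (Dom B (Fa R r)) \<and> Fa R r \<cdot>\<^bsub>B\<^esub> Fa R h = u \<and> Fa R t \<cdot>\<^bsub>B\<^esub> Fa R h = v"
        using arg_cong[OF h(4), of "Fa R"] arg_cong[OF h(5), of "Fa R"] h(1-3) rt x u v p
        by (simp add: hom_def)
    next
      fix k assume "k \<in> hom B x (Dom B (Fa R r)) \<and> Fa R r \<cdot>\<^bsub>B\<^esub> k = u \<and> Fa R t \<cdot>\<^bsub>B\<^esub> k = v"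
      then have k: "k \<in> Ar B" "Dom B k = x" "Cod B k = Fo R (Dom X r)"
          "Fa R r \<cdot>\<^bsub>B\<^esub> k = u" "Fa R t \<cdot>\<^bsub>B\<^esub> k = v"
        using rt by (auto simp: hom_def)
      \<comment> \<open>Uniqueness is tested on transposes, in the pullback in \<open>X\<close>.\<close>
      let ?k = "\<sigma> (Dom X r) \<cdot>\<^bsub>X\<^esub> Fa L k"
      have "s \<cdot>\<^bsub>X\<^esub> ?k = \<sigma> (Cod X s) \<cdot>\<^bsub>X\<^esub> Fa L (Fa R s \<cdot>\<^bsub>B\<^esub> k)"
        if s: "s \<in> Ar X" "Dom X s = Dom X r" for s
      proof -
        have "s \<cdot>\<^bsub>X\<^esub> ?k = (s \<cdot>\<^bsub>X\<^esub> \<sigma> (Dom X s)) \<cdot>\<^bsub>X\<^esub> Fa L k"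
          using s k rt(1) by (simp add: X.Cmp_assoc')
        then show ?thesis
          unfolding counit_natural[OF s(1), symmetric]
          using s k rt(1) by (simp add: X.Cmp_assoc'[symmetric])
      qed
      from this[of r] this[of t] have "r \<cdot>\<^bsub>X\<^esub> ?k = ?u" "t \<cdot>\<^bsub>X\<^esub> ?k = Fa L v"
        using rt k v w by simp_all
      moreover have "?k \<in> hom X (Fo L x) (Dom X r)" "h \<in> hom X (Fo L x) (Dom X r)"
        using h(1-3) k(1-3) rt(1) by (simp_all add: hom_def)
      ultimately have "?k = h"
        using ex1 h(4,5) by blast
      then show "k = Fa R h" using k rt by auto
    qed
  qed (use p w rt in simp_all)
  then show "\<exists>r s. is_pullback B (Fa R p) w r s" by blast
qed

text \<open>The assumption says that every object with an arrow to an object of the subcategory is itself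
  isomorphic to one. For \<open>d\<close> in the slice over the codomain of \<open>p\<close> whose domain is in the subcategory, the
  counit \<open>\<epsilon> d\<close> of \<open>p\<^sub>! -| p\<^sup>*\<close> is an arrow from the domain of \<open>p\<^sup>* d\<close> to that of \<open>d\<close>, so the assumption
  shows that \<open>p\<^sup>*\<close> respects the subcategories.\<close>

theorem R_preserves_effective_descent:
  assumes sieve: "\<And>k b. \<lbrakk>k \<in> Ar X; b \<in> Ob B; Cod X k = Fo L b\<rbrakk> \<Longrightarrow> iso_arr X (\<sigma> (Dom X k))"
  shows "preserves_effective_descent X B R"
  unfolding preserves_effective_descent_def
proof (intro conjI ballI impI R_functor)
  fix p assume p: "p \<in> Ar X" and "effective_descent X p"
  then obtain U \<eta> \<epsilon> where pb: "has_pullbacks_along X p"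
    and M: "monadic_adjunction (slice_cat X (Dom X p)) (slice_cat X (Cod X p)) (postcomp_ftr X p) U \<eta> \<epsilon>"
    unfolding effective_descent_def by blast
  let ?f = "Dom X p" and ?g = "Cod X p"
  have adj: "adjunction (slice_cat X ?f) (slice_cat X ?g) (postcomp_ftr X p) U \<eta> \<epsilon>"
    using M by (simp add: monadic_adjunction_def)
  note simps = B.slice_simps B.slice_Ar X.slice_simps X.slice_Ar slice_L_def slice_counit_def
  interpret C: coreflection "slice_cat B (Fo R ?f)" "slice_cat X ?f" "slice_L ?f" "slice_ftr X R"
      slice_counit
    by (rule slice_coreflection) (use p in simp)
  interpret D: coreflection "slice_cat B (Fo R ?g)" "slice_cat X ?g" "slice_L ?g" "slice_ftr X R"
      slice_counit
    by (rule slice_coreflection) (use p in simp)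
  have F_L: "p \<cdot>\<^bsub>X\<^esub> (\<sigma> ?f \<cdot>\<^bsub>X\<^esub> Fa L w) = \<sigma> ?g \<cdot>\<^bsub>X\<^esub> (Fa L (Fa R p) \<cdot>\<^bsub>X\<^esub> Fa L w)"
    if "w \<in> Ar B" "Cod B w = Fo R ?f" for w
    using that p by (simp add: X.Cmp_assoc' counit_natural)
  interpret adjunction_over_coreflections
      "slice_cat B (Fo R ?f)" "slice_cat X ?f" "slice_L ?f" "slice_ftr X R" slice_counit
      "slice_cat B (Fo R ?g)" "slice_cat X ?g" "slice_L ?g" "slice_ftr X R" slice_counit
      "postcomp_ftr X p" U \<eta> \<epsilon> "postcomp_ftr B (Fa R p)"
  proof
    show "is_functor (slice_cat B (Fo R ?f)) (slice_cat B (Fo R ?g)) (postcomp_ftr B (Fa R p))"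
      using B.postcomp_functor[of "Fa R p"] p by simp
  next
    fix k assume "k \<in> Ar (slice_cat B (Fo R ?f))"
    then show "Fa (postcomp_ftr X p) (Fa (slice_L ?f) k) = Fa (slice_L ?g) (Fa (postcomp_ftr B (Fa R p)) k)"
      using p by (cases k) (auto simp: simps F_L)
  next
    fix k assume "k \<in> Ar (slice_cat X ?f)"
    then show "Fa (slice_ftr X R) (Fa (postcomp_ftr X p) k) = Fa (postcomp_ftr B (Fa R p)) (Fa (slice_ftr X R) k)"
      using p by (cases k) (auto simp: simps)
  next
    fix t assume "t \<in> Ob (slice_cat X ?f)"
    then show "Fa (postcomp_ftr X p) (slice_counit t) = slice_counit (Fo (postcomp_ftr X p) t)"
      using p by (auto simp: simps F_L)
  next
    fix w assume w: "w \<in> Ob (slice_cat B (Fo R ?g))"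
    let ?d = "Fo (slice_L ?g) w"
    have d: "?d \<in> Ob (slice_cat X ?g)" using w by simp
    let ?c = "Fo U ?d"
    have c: "?c \<in> Ar X" "Cod X ?c = ?f"
      using is_functorD(3)[OF adjunctionD(2)[OF adj] d] by (simp_all add: simps)
    obtain k where "\<epsilon> ?d = (p \<cdot>\<^bsub>X\<^esub> ?c, k, ?d)"
      using nat_transD(4,5)[OF adjunctionD(4)[OF adj] d]
      by (cases "\<epsilon> ?d") (simp add: X.slice_simps)
    then have "k \<in> Ar X" "Dom X k = Dom X ?c" "Cod X k = Fo L (Dom B w)"
      using nat_transD(3)[OF adjunctionD(4)[OF adj] d] c w p by (simp_all add: simps)
    then have "iso_arr X (\<sigma> (Dom X ?c))"
      using sieve[of k "Dom B w"] w by (simp add: B.slice_simps)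
    then show "iso_arr (slice_cat X ?f) (slice_counit ?c)"
      using C.counit_simps(1)[of ?c] c
      unfolding slice_counit_def by (intro X.slice_iso_arr) (simp_all add: X.slice_simps)
  qed (use p adj in \<open>auto simp: simps F_L\<close>)
  show "effective_descent B (Fa R p)"
    unfolding effective_descent_def
    using p R_has_pullbacks_along[OF p pb] monadic_restricts[OF M] by auto
qed

end

section \<open>The codomain functor of an arrow category\<close>

locale category_with_strict_initial = category A for A :: "('o, 'm) cat" (structure) +
  fixes z :: 'o
  assumes strict: "strict_initial A z"
begin

lemma init: "initial A z"
  using strict by (simp add: strict_initial_def)

definition from_initial :: "'o \<Rightarrow> 'm" where
  "from_initial x = (THE f. f \<in> hom A z x)"

lemma z_Ob [simp]: "z \<in> Ob A"
  using init by (simp add: initial_def)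

lemma from_initial_simps [simp]:
  assumes "x \<in> Ob A"
  shows "from_initial x \<in> Ar A" "Dom A (from_initial x) = z" "Cod A (from_initial x) = x"
proof -
  have "from_initial x \<in> hom A z x"
    unfolding from_initial_def by (rule theI') (use init assms in \<open>simp add: initial_def\<close>)
  then show "from_initial x \<in> Ar A" "Dom A (from_initial x) = z" "Cod A (from_initial x) = x"
    by (auto simp: hom_def)
qed

lemma from_initial_unique:
  assumes f: "f \<in> Ar A" "Dom A f = z" "Cod A f = x"
  shows "f = from_initial x"
proof -
  have x: "x \<in> Ob A" using Cod_in[OF f(1)] f(3) by simp
  then have "\<exists>!h. h \<in> hom A z x" using init by (simp add: initial_def)
  then show ?thesis using f from_initial_simps[OF x] by (auto simp: hom_def)
qed

lemma Cmp_from_initial [simp]: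
  "\<lbrakk>f \<in> Ar A; x = Dom A f\<rbrakk> \<Longrightarrow> f \<cdot> from_initial x = from_initial (Cod A f)"
  by (rule from_initial_unique) simp_all

lemma from_initial_initial [simp]: "from_initial z = Ide A z"
  by (rule from_initial_unique[symmetric]) simp_all

text \<open>Here strictness is used: whatever maps to \<open>z\<close> is itself initial.\<close>

lemma from_initial_iso:
  assumes k: "k \<in> Ar A" "Cod A k = z"
  shows "iso_arr A (from_initial (Dom A k))"
proof -
  let ?x = "Dom A k"
  have "isomorphic A ?x z"
    using strict k by (auto simp: strict_initial_def hom_def)
  then obtain e where e: "iso_arr A e" "Dom A e = ?x" "Cod A e = z"
    by (auto simp: isomorphic_def hom_def)
  obtain d where d: "d \<in> Ar A" "Dom A d = Cod A e" "Cod A d = Dom A e"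
    "d \<cdot> e = Ide A (Dom A e)" "e \<cdot> d = Ide A (Cod A e)"
    by (rule iso_arr_inverse[OF e(1)])
  have "d = from_initial ?x" using d e by (intro from_initial_unique) simp_all
  then show ?thesis
    using d e iso_arr_in_Ar[OF e(1)] by (intro iso_arrI[of _ _ e]) simp_all
qed

definition initial_arrow_ftr :: "('o, 'm, 'm, 'm \<times> 'm \<times> 'm \<times> 'm) ftr" where
  "initial_arrow_ftr = \<lparr>Fo = from_initial,
     Fa = (\<lambda>h. (from_initial (Dom A h), Ide A z, h, from_initial (Cod A h)))\<rparr>"

definition cod_counit :: "'m \<Rightarrow> 'm \<times> 'm \<times> 'm \<times> 'm" where
  "cod_counit f = (from_initial (Cod A f), from_initial (Dom A f), Ide A (Cod A f), f)"

text \<open>A square from \<open>z \<rightarrow> x\<close> to \<open>f\<close> is determined by its codomain component, because its domain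
  component starts at \<open>z\<close>.\<close>

lemma cod_coreflection:
  "coreflection A (arrow_cat A) initial_arrow_ftr (cod_ftr A) cod_counit"
proof
  note simps = arrow_cat_def initial_arrow_ftr_def cod_ftr_def cod_counit_def hom_def
  show L: "is_functor A (arrow_cat A) initial_arrow_ftr"
    using category_axioms arrow_category by (auto simp: is_functor_def simps)
  show R: "is_functor (arrow_cat A) A (cod_ftr A)" by (rule cod_functor)
  have "is_functor (arrow_cat A) (arrow_cat A) id_ftr"
    using arrow_category by (auto simp: is_functor_def simps)
  then show "nat_trans (arrow_cat A) (arrow_cat A) (comp_ftr initial_arrow_ftr (cod_ftr A)) id_ftr
      cod_counit"
    unfolding nat_trans_def using comp_functor[OF R L] by (auto simp: simps)
qed (auto simp: arrow_cat_def initial_arrow_ftr_def cod_ftr_def cod_counit_def)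

text \<open>The counit at \<open>f\<close> consists of \<open>z \<rightarrow> dom f\<close> and an identity, so it is invertible as soon as
  the domain of \<open>f\<close> is initial.\<close>

lemma cod_counit_iso:
  assumes k: "k \<in> Ar (arrow_cat A)" "Cod (arrow_cat A) k = from_initial c" and c: "c \<in> Ob A"
  shows "iso_arr (arrow_cat A) (cod_counit (Dom (arrow_cat A) k))"
proof -
  obtain f u v g where kd: "k = (f, u, v, g)" by (cases k)
  have f: "f \<in> Ar A" and u: "u \<in> Ar A" "Dom A u = Dom A f" "Cod A u = z"
    using k c by (auto simp: kd arrow_cat_def hom_def)
  have "iso_arr A (from_initial (Dom A f))"
    using from_initial_iso[OF u(1,3)] u by simp
  then obtain d where d: "d \<in> Ar A" "Dom A d = Dom A f" "Cod A d = z"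
    "d \<cdot> from_initial (Dom A f) = Ide A z" "from_initial (Dom A f) \<cdot> d = Ide A (Dom A f)"
    by (rule iso_arr_inverse) (use f in simp)
  have "f \<cdot> (from_initial (Dom A f) \<cdot> d) = from_initial (Cod A f) \<cdot> d"
    using f d(1-3) by (simp add: Cmp_assoc')
  then have "from_initial (Cod A f) \<cdot> d = f" using d f by simp
  then show ?thesis
    by (intro iso_arrI[of _ _ "(f, d, Ide A (Cod A f), from_initial (Cod A f))"])
      (use f d in \<open>simp_all add: kd arrow_cat_def cod_counit_def hom_def\<close>)
qed

end

theorem lemma21:
  fixes A :: "('o, 'm) cat"
  assumes "category A"
    and "\<exists>z. strict_initial A z"
  shows "preserves_effective_descent (arrow_cat A) A (cod_ftr A)"
proof -
  obtain z where "strict_initial A z" using assms(2) by blast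
  then interpret category_with_strict_initial A z
    using assms(1) by (simp add: category_with_strict_initial_def category_with_strict_initial_axioms_def)
  interpret coreflection A "arrow_cat A" initial_arrow_ftr "cod_ftr A" cod_counit
    by (rule cod_coreflection)
  show ?thesis
    by (rule R_preserves_effective_descent)
      (use cod_counit_iso in \<open>simp add: initial_arrow_ftr_def\<close>)
qed

end
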